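(* Let $\{G_i\mid i\in I\}$ be a family of nontrivial Gödel algebras. Then the coproduct of $\{G_i\mid i\in I\}$ in the category of Gödel algebras has depth $1+\sum_{i\in I}(d(G_i)-1)$, where this expression is interpreted as $\infty$ if $d(G_i)=\infty$ for some $i$ or if $J=\{i\in I\mid d(G_i)>1\}$ is infinite, and as $1+\sum_{i\in J}(d(G_i)-1)$ otherwise.
   Context: A Gödel algebra is a Heyting algebra satisfying $(x\to y)\vee(y\to x)=1$. Define terms $\mathsf{bd}_0=0$ and $\mathsf{bd}_n=x_n\vee(x_n\to\mathsf{bd}_{n-1})$, and let $\mathsf{GA}_n$ be the class of Gödel algebras satisfying $\mathsf{bd}_n=1$. The depth $d(G)\in\mathbb{N}\cup\{\infty\}$ of a Gödel algebra $G$ is the least $n$ with $G\in\mathsf{GA}_n$, or $\infty$ if there is none. (Equivalently, $d(G)$ is the supremum over prime filters $P$ of $G$ of the number of prime filters containing $P$.) *)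

theory Defs
  imports "HOL-Algebra.Lattice" "HOL-Library.Extended_Nat" "HOL-Library.FuncSet"
begin

section \<open>Heyting and Goedel algebras\<close>

locale heyting_algebra = bounded_lattice +
  assumes relative_pseudocomplement_exists:
    "\<lbrakk>x \<in> carrier L; y \<in> carrier L\<rbrakk>
      \<Longrightarrow> \<exists>z. greatest L z {w \<in> carrier L. w \<sqinter> x \<sqsubseteq> y}"

definition heyting_imp :: "_ \<Rightarrow> 'a \<Rightarrow> 'a \<Rightarrow> 'a" (infixr \<open>\<leadsto>\<index>\<close> 60)
  where "x \<leadsto>\<^bsub>L\<^esub> y = (SOME z. greatest L z {w \<in> carrier L. w \<sqinter>\<^bsub>L\<^esub> x \<sqsubseteq>\<^bsub>L\<^esub> y})"

locale godel_algebra = heyting_algebra +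
  assumes prelinear:
    "\<lbrakk>x \<in> carrier L; y \<in> carrier L\<rbrakk> \<Longrightarrow> (x \<leadsto> y) \<squnion> (y \<leadsto> x) = \<top>"

definition nontrivial :: "'a gorder \<Rightarrow> bool"
  where "nontrivial L \<longleftrightarrow> \<bottom>\<^bsub>L\<^esub> \<noteq> \<top>\<^bsub>L\<^esub>"

definition godel_hom :: "'a gorder \<Rightarrow> 'b gorder \<Rightarrow> ('a \<Rightarrow> 'b) set"
  where "godel_hom G H =
    {h \<in> carrier G \<rightarrow> carrier H.
       join_pres G H h \<and> meet_pres G H h \<and>
       (\<forall>x\<in>carrier G. \<forall>y\<in>carrier G. h (x \<leadsto>\<^bsub>G\<^esub> y) = h x \<leadsto>\<^bsub>H\<^esub> h y) \<and>
       h \<bottom>\<^bsub>G\<^esub> = \<bottom>\<^bsub>H\<^esub> \<and> h \<top>\<^bsub>G\<^esub> = \<top>\<^bsub>H\<^esub>}"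


section \<open>Depth\<close>

text \<open>\<open>bd L x n\<close> is the value of the term \<open>bd_n\<close> in \<open>L\<close> under the assignment \<open>x\<close>.\<close>

primrec bd :: "'a gorder \<Rightarrow> (nat \<Rightarrow> 'a) \<Rightarrow> nat \<Rightarrow> 'a"
  where
    "bd L x 0 = \<bottom>\<^bsub>L\<^esub>"
  | "bd L x (Suc n) = x (Suc n) \<squnion>\<^bsub>L\<^esub> (x (Suc n) \<leadsto>\<^bsub>L\<^esub> bd L x n)"

definition GA :: "nat \<Rightarrow> 'a gorder set"
  where "GA n = {L. godel_algebra L \<and> (\<forall>x \<in> UNIV \<rightarrow> carrier L. bd L x n = \<top>\<^bsub>L\<^esub>)}"

definition depth :: "'a gorder \<Rightarrow> enat"
  where "depth L = (if \<exists>n. L \<in> GA n then enat (LEAST n. L \<in> GA n) else \<infinity>)"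


section \<open>Coproducts\<close>

text \<open>
  The universal property of a coproduct, tested against the Goedel algebras whose carrier
  is a subset of the type \<open>'h\<close>. Homomorphisms only matter on the carrier, so uniqueness is
  stated for extensional functions.
\<close>

definition is_coproduct_wrt ::
  "'h itself \<Rightarrow> 'i set \<Rightarrow> ('i \<Rightarrow> 'a gorder) \<Rightarrow> 'c gorder \<Rightarrow> ('i \<Rightarrow> 'a \<Rightarrow> 'c) \<Rightarrow> bool"
  where "is_coproduct_wrt (_ :: 'h itself) I G C \<iota> \<longleftrightarrow>
    godel_algebra C \<and> (\<forall>i\<in>I. \<iota> i \<in> godel_hom (G i) C) \<and>
    (\<forall>(H :: 'h gorder) f. godel_algebra H \<and> (\<forall>i\<in>I. f i \<in> godel_hom (G i) H) \<longrightarrow>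
      (\<exists>!h. h \<in> godel_hom C H \<and> h \<in> extensional (carrier C) \<and>
            (\<forall>i\<in>I. \<forall>x\<in>carrier (G i). h (\<iota> i x) = f i x)))"

text \<open>
  HOL cannot quantify over all types inside a formula. The test type chosen here is large
  enough: theorem \<open>is_coproduct_imp_wrt\<close> below shows that \<open>is_coproduct\<close> implies the
  universal property with respect to Goedel algebras over every type, and
  \<open>is_coproduct_exists\<close> that every family of Goedel algebras has a coproduct.
\<close>

definition is_coproduct ::
  "'i set \<Rightarrow> ('i \<Rightarrow> 'a gorder) \<Rightarrow> 'c gorder \<Rightarrow> ('i \<Rightarrow> 'a \<Rightarrow> 'c) \<Rightarrow> bool"
  where "is_coproduct I G C \<iota> \<longleftrightarrow> is_coproduct_wrt TYPE('c + ('i \<times> 'a) list) I G C \<iota>"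


section \<open>The chosen test type suffices\<close>

subsection \<open>Basic facts\<close>

context heyting_algebra
begin

lemma heyting_imp_greatest:
  assumes "x \<in> carrier L" "y \<in> carrier L"
  shows "greatest L (x \<leadsto> y) {w \<in> carrier L. w \<sqinter> x \<sqsubseteq> y}"
  unfolding heyting_imp_def
  by (rule someI_ex) (rule relative_pseudocomplement_exists[OF assms])

lemma heyting_imp_closed [simp, intro]:
  "\<lbrakk>x \<in> carrier L; y \<in> carrier L\<rbrakk> \<Longrightarrow> x \<leadsto> y \<in> carrier L"
  using heyting_imp_greatest[of x y] by (auto simp: greatest_def)

lemma heyting_imp_iff:
  assumes "w \<in> carrier L" "x \<in> carrier L" "y \<in> carrier L"
  shows "w \<sqsubseteq> x \<leadsto> y \<longleftrightarrow> w \<sqinter> x \<sqsubseteq> y"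
proof
  assume "w \<sqinter> x \<sqsubseteq> y"
  then show "w \<sqsubseteq> x \<leadsto> y"
    using heyting_imp_greatest[of x y] assms by (auto simp: greatest_def)
next
  assume w: "w \<sqsubseteq> x \<leadsto> y"
  have "w \<sqinter> x \<sqsubseteq> (x \<leadsto> y) \<sqinter> x"
    using assms w by (meson heyting_imp_closed le_trans meet_closed meet_le meet_left meet_right)
  moreover have "(x \<leadsto> y) \<sqinter> x \<sqsubseteq> y"
    using heyting_imp_greatest[of x y] assms by (auto simp: greatest_def)
  ultimately show "w \<sqinter> x \<sqsubseteq> y"
    using assms by (meson heyting_imp_closed le_trans meet_closed)
qed

end

lemma godel_algebraI:
  fixes L :: "'a gorder" (structure)
  assumes eq: "(.=) = (=)"
    and R: "\<And>x. x \<in> carrier L \<Longrightarrow> x \<sqsubseteq> x"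
    and A: "\<And>x y. \<lbrakk>x \<in> carrier L; y \<in> carrier L; x \<sqsubseteq> y; y \<sqsubseteq> x\<rbrakk> \<Longrightarrow> x = y"
    and T: "\<And>x y z. \<lbrakk>x \<in> carrier L; y \<in> carrier L; z \<in> carrier L; x \<sqsubseteq> y; y \<sqsubseteq> z\<rbrakk> \<Longrightarrow> x \<sqsubseteq> z"
    and bc: "b \<in> carrier L" and b: "\<And>x. x \<in> carrier L \<Longrightarrow> b \<sqsubseteq> x"
    and tc: "t \<in> carrier L" and t: "\<And>x. x \<in> carrier L \<Longrightarrow> x \<sqsubseteq> t"
    and mc: "\<And>x y. \<lbrakk>x \<in> carrier L; y \<in> carrier L\<rbrakk> \<Longrightarrow> m x y \<in> carrier L"
    and m: "\<And>w x y. \<lbrakk>w \<in> carrier L; x \<in> carrier L; y \<in> carrier L\<rbrakk> \<Longrightarrow> w \<sqsubseteq> m x y \<longleftrightarrow> w \<sqsubseteq> x \<and> w \<sqsubseteq> y"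
    and jc: "\<And>x y. \<lbrakk>x \<in> carrier L; y \<in> carrier L\<rbrakk> \<Longrightarrow> j x y \<in> carrier L"
    and j: "\<And>w x y. \<lbrakk>w \<in> carrier L; x \<in> carrier L; y \<in> carrier L\<rbrakk> \<Longrightarrow> j x y \<sqsubseteq> w \<longleftrightarrow> x \<sqsubseteq> w \<and> y \<sqsubseteq> w"
    and ic: "\<And>x y. \<lbrakk>x \<in> carrier L; y \<in> carrier L\<rbrakk> \<Longrightarrow> i x y \<in> carrier L"
    and i: "\<And>w x y. \<lbrakk>w \<in> carrier L; x \<in> carrier L; y \<in> carrier L\<rbrakk> \<Longrightarrow> w \<sqsubseteq> i x y \<longleftrightarrow> m w x \<sqsubseteq> y"
    and pl: "\<And>x y. \<lbrakk>x \<in> carrier L; y \<in> carrier L\<rbrakk> \<Longrightarrow> t \<sqsubseteq> j (i x y) (i y x)"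
  shows "godel_algebra L"
    and "\<bottom> = b" and "\<top> = t"
    and "\<And>x y. \<lbrakk>x \<in> carrier L; y \<in> carrier L\<rbrakk> \<Longrightarrow> x \<sqinter> y = m x y"
    and "\<And>x y. \<lbrakk>x \<in> carrier L; y \<in> carrier L\<rbrakk> \<Longrightarrow> x \<squnion> y = j x y"
    and "\<And>x y. \<lbrakk>x \<in> carrier L; y \<in> carrier L\<rbrakk> \<Longrightarrow> x \<leadsto> y = i x y"
proof -
  interpret partial_order L
  proof unfold_locales
    show "x .= y" if "x \<sqsubseteq> y" "y \<sqsubseteq> x" "x \<in> carrier L" "y \<in> carrier L" for x y
      unfolding eq by (rule A) (fact that)+
    show "x \<sqsubseteq> z" if "x \<sqsubseteq> y" "y \<sqsubseteq> z" "x \<in> carrier L" "y \<in> carrier L" "z \<in> carrier L" for x y z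
      by (rule T[of x y z]) (fact that)+
  qed (simp_all add: eq R)
  have gm: "greatest L (m x y) (Lower L {x, y})" if "x \<in> carrier L" "y \<in> carrier L" for x y
  proof -
    have "m x y \<sqsubseteq> x \<and> m x y \<sqsubseteq> y"
      using m[OF mc[OF that] that] R[OF mc[OF that]] by simp
    then show ?thesis
      by (intro greatest_LowerI) (auto simp: Lower_def that mc m)
  qed
  have lj: "least L (j x y) (Upper L {x, y})" if "x \<in> carrier L" "y \<in> carrier L" for x y
  proof -
    have "x \<sqsubseteq> j x y \<and> y \<sqsubseteq> j x y"
      using j[OF jc[OF that] that] R[OF jc[OF that]] by simp
    then show ?thesis
      by (intro least_UpperI) (auto simp: Upper_def that jc j)
  qed
  have lb: "least L b (carrier L)" unfolding least_def using bc b by blast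
  have gt: "greatest L t (carrier L)" unfolding greatest_def using tc t by blast
  interpret bounded_lattice L
    by unfold_locales (rule exI, rule lj gm lb gt, assumption?, assumption?)+
  show bot: "\<bottom> = b"
    by (rule bottom_eq[OF bc b, symmetric])
  show top: "\<top> = t"
    by (rule top_eq[OF tc t, symmetric])
  show meet: "x \<sqinter> y = m x y" if "x \<in> carrier L" "y \<in> carrier L" for x y
    unfolding Lattice.meet_def using that
    by (intro greatest_unique[OF inf_of_two_greatest gm])
  show join: "x \<squnion> y = j x y" if "x \<in> carrier L" "y \<in> carrier L" for x y
    unfolding Lattice.join_def using that
    by (intro least_unique[OF sup_of_two_least lj])
  have gi: "greatest L (i x y) {w \<in> carrier L. w \<sqinter> x \<sqsubseteq> y}"
    if "x \<in> carrier L" "y \<in> carrier L" for x y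
  proof -
    have "m (i x y) x \<sqsubseteq> y"
      using i[OF ic[OF that] that] R[OF ic[OF that]] by simp
    then show ?thesis
      using that ic[OF that] by (auto simp: greatest_def meet i)
  qed
  interpret heyting_algebra L
    by unfold_locales (rule exI, rule gi)
  show imp: "x \<leadsto> y = i x y" if "x \<in> carrier L" "y \<in> carrier L" for x y
    using that by (intro greatest_unique[OF heyting_imp_greatest gi])
  show "godel_algebra L"
  proof unfold_locales
    fix x y assume xy: "x \<in> carrier L" "y \<in> carrier L"
    have "j (i x y) (i y x) = t"
      by (rule A) (simp_all add: xy ic jc tc t pl)
    then show "(x \<leadsto> y) \<squnion> (y \<leadsto> x) = \<top>"
      using xy by (simp add: imp join ic top)
  qed
qed

lemma godel_homI:
  assumes "godel_algebra G" "godel_algebra H" "h \<in> carrier G \<rightarrow> carrier H"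
    and "\<And>x y. \<lbrakk>x \<in> carrier G; y \<in> carrier G\<rbrakk> \<Longrightarrow> h (x \<squnion>\<^bsub>G\<^esub> y) = h x \<squnion>\<^bsub>H\<^esub> h y"
    and "\<And>x y. \<lbrakk>x \<in> carrier G; y \<in> carrier G\<rbrakk> \<Longrightarrow> h (x \<sqinter>\<^bsub>G\<^esub> y) = h x \<sqinter>\<^bsub>H\<^esub> h y"
    and "\<And>x y. \<lbrakk>x \<in> carrier G; y \<in> carrier G\<rbrakk> \<Longrightarrow> h (x \<leadsto>\<^bsub>G\<^esub> y) = h x \<leadsto>\<^bsub>H\<^esub> h y"
    and "h \<bottom>\<^bsub>G\<^esub> = \<bottom>\<^bsub>H\<^esub>" "h \<top>\<^bsub>G\<^esub> = \<top>\<^bsub>H\<^esub>"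
  shows "h \<in> godel_hom G H"
proof -
  interpret G: godel_algebra G by fact
  interpret H: godel_algebra H by fact
  have "lattice G" "lattice H" by unfold_locales
  then show ?thesis
    using assms by (simp add: godel_hom_def join_pres_def meet_pres_def)
qed

lemma godel_homD:
  assumes "h \<in> godel_hom G H"
  shows "h \<in> carrier G \<rightarrow> carrier H"
    and "x \<in> carrier G \<Longrightarrow> h x \<in> carrier H"
    and "\<lbrakk>x \<in> carrier G; y \<in> carrier G\<rbrakk> \<Longrightarrow> h (x \<squnion>\<^bsub>G\<^esub> y) = h x \<squnion>\<^bsub>H\<^esub> h y"
    and "\<lbrakk>x \<in> carrier G; y \<in> carrier G\<rbrakk> \<Longrightarrow> h (x \<sqinter>\<^bsub>G\<^esub> y) = h x \<sqinter>\<^bsub>H\<^esub> h y"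
    and "\<lbrakk>x \<in> carrier G; y \<in> carrier G\<rbrakk> \<Longrightarrow> h (x \<leadsto>\<^bsub>G\<^esub> y) = h x \<leadsto>\<^bsub>H\<^esub> h y"
    and "h \<bottom>\<^bsub>G\<^esub> = \<bottom>\<^bsub>H\<^esub>" and "h \<top>\<^bsub>G\<^esub> = \<top>\<^bsub>H\<^esub>"
  using assms by (auto simp: godel_hom_def join_pres_def meet_pres_def)

lemma godel_hom_comp:
  assumes f: "f \<in> godel_hom F G" and g: "g \<in> godel_hom G H"
    and "godel_algebra F" "godel_algebra H"
  shows "(\<lambda>x. g (f x)) \<in> godel_hom F H"
  using assms(3,4) by (rule godel_homI) (simp_all add: godel_homD[OF f] godel_homD[OF g])

lemma godel_hom_cong:
  assumes f: "f \<in> godel_hom G H" and "godel_algebra G" "godel_algebra H"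
    and eq: "\<And>x. x \<in> carrier G \<Longrightarrow> g x = f x"
  shows "g \<in> godel_hom G H"
proof -
  interpret G: godel_algebra G by fact
  show ?thesis
    using assms(2,3) by (rule godel_homI) (simp_all add: godel_homD[OF f] eq)
qed


subsection \<open>Subalgebras\<close>

inductive_set generated :: "'a gorder \<Rightarrow> 'a set \<Rightarrow> 'a set"
  for L :: "'a gorder" and X :: "'a set" where
    gen_base: "x \<in> X \<Longrightarrow> x \<in> generated L X"
  | gen_bot: "\<bottom>\<^bsub>L\<^esub> \<in> generated L X"
  | gen_top: "\<top>\<^bsub>L\<^esub> \<in> generated L X"
  | gen_meet: "\<lbrakk>x \<in> generated L X; y \<in> generated L X\<rbrakk> \<Longrightarrow> x \<sqinter>\<^bsub>L\<^esub> y \<in> generated L X"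
  | gen_join: "\<lbrakk>x \<in> generated L X; y \<in> generated L X\<rbrakk> \<Longrightarrow> x \<squnion>\<^bsub>L\<^esub> y \<in> generated L X"
  | gen_imp: "\<lbrakk>x \<in> generated L X; y \<in> generated L X\<rbrakk> \<Longrightarrow> x \<leadsto>\<^bsub>L\<^esub> y \<in> generated L X"

lemma generated_subset:
  assumes "godel_algebra L" "X \<subseteq> carrier L"
  shows "generated L X \<subseteq> carrier L"
proof
  interpret godel_algebra L by fact
  fix x assume "x \<in> generated L X"
  then show "x \<in> carrier L" by induction (use assms in auto)
qed

text \<open>The subalgebra of \<open>H\<close> generated by \<open>X\<close>, transported along an injection \<open>e\<close>.\<close>

lemma generated_copy:
  fixes H :: "'k gorder" and e :: "'k \<Rightarrow> 'u"
  assumes H: "godel_algebra H" and X: "X \<subseteq> carrier H" and e: "inj_on e (generated H X)"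
  defines "S \<equiv> generated H X"
  defines "K \<equiv> \<lparr>carrier = e ` S, eq = (=),
                 le = (\<lambda>x y. inv_into S e x \<sqsubseteq>\<^bsub>H\<^esub> inv_into S e y)\<rparr>"
  shows "godel_algebra K"
    and "inv_into S e \<in> godel_hom K H"
proof -
  interpret H: godel_algebra H by fact
  let ?d = "inv_into S e"
  have SH: "x \<in> carrier H" if "x \<in> S" for x
    using generated_subset[OF H X] that by (auto simp: S_def)
  have d [simp]: "?d (e x) = x" if "x \<in> S" for x
    using e that by (simp add: S_def)
  have cl [simp]: "\<bottom>\<^bsub>H\<^esub> \<in> S" "\<top>\<^bsub>H\<^esub> \<in> S"
    "\<And>x y. x \<in> S \<Longrightarrow> y \<in> S \<Longrightarrow> x \<sqinter>\<^bsub>H\<^esub> y \<in> S"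
    "\<And>x y. x \<in> S \<Longrightarrow> y \<in> S \<Longrightarrow> x \<squnion>\<^bsub>H\<^esub> y \<in> S"
    "\<And>x y. x \<in> S \<Longrightarrow> y \<in> S \<Longrightarrow> x \<leadsto>\<^bsub>H\<^esub> y \<in> S"
    unfolding S_def by (blast intro: generated.intros)+
  have m: "w \<sqsubseteq>\<^bsub>H\<^esub> x \<sqinter>\<^bsub>H\<^esub> y \<longleftrightarrow> w \<sqsubseteq>\<^bsub>H\<^esub> x \<and> w \<sqsubseteq>\<^bsub>H\<^esub> y"
    if "w \<in> S" "x \<in> S" "y \<in> S" for w x y
    using SH[OF that(1)] SH[OF that(2)] SH[OF that(3)]
    by (meson H.le_trans H.meet_closed H.meet_le H.meet_left H.meet_right)
  have j: "x \<squnion>\<^bsub>H\<^esub> y \<sqsubseteq>\<^bsub>H\<^esub> w \<longleftrightarrow> x \<sqsubseteq>\<^bsub>H\<^esub> w \<and> y \<sqsubseteq>\<^bsub>H\<^esub> w"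
    if "w \<in> S" "x \<in> S" "y \<in> S" for w x y
    using SH[OF that(1)] SH[OF that(2)] SH[OF that(3)]
    by (meson H.le_trans H.join_closed H.join_le H.join_left H.join_right)
  have KK: "godel_algebra K \<and> \<bottom>\<^bsub>K\<^esub> = e \<bottom>\<^bsub>H\<^esub> \<and> \<top>\<^bsub>K\<^esub> = e \<top>\<^bsub>H\<^esub> \<and>
    (\<forall>x\<in>carrier K. \<forall>y\<in>carrier K. x \<sqinter>\<^bsub>K\<^esub> y = e (?d x \<sqinter>\<^bsub>H\<^esub> ?d y) \<and>
       x \<squnion>\<^bsub>K\<^esub> y = e (?d x \<squnion>\<^bsub>H\<^esub> ?d y) \<and> x \<leadsto>\<^bsub>K\<^esub> y = e (?d x \<leadsto>\<^bsub>H\<^esub> ?d y))"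
  proof -
    have cK: "carrier K = e ` S" and eK: "eq K = (=)" by (simp_all add: K_def)
    have le: "e x \<sqsubseteq>\<^bsub>K\<^esub> e y \<longleftrightarrow> x \<sqsubseteq>\<^bsub>H\<^esub> y" if "x \<in> S" "y \<in> S" for x y
      using that by (simp add: K_def)
    have i: "w \<sqsubseteq>\<^bsub>H\<^esub> x \<leadsto>\<^bsub>H\<^esub> y \<longleftrightarrow> w \<sqinter>\<^bsub>H\<^esub> x \<sqsubseteq>\<^bsub>H\<^esub> y"
      if "w \<in> S" "x \<in> S" "y \<in> S" for w x y
      using that SH by (simp add: H.heyting_imp_iff)
    have R: "x \<sqsubseteq>\<^bsub>K\<^esub> x" if "x \<in> carrier K" for x
      using that by (auto simp: cK le SH)
    have A: "x = y" if "x \<in> carrier K" "y \<in> carrier K" "x \<sqsubseteq>\<^bsub>K\<^esub> y" "y \<sqsubseteq>\<^bsub>K\<^esub> x" for x y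
      using that by (auto simp: cK le dest: H.le_antisym[OF _ _ SH SH])
    have T: "x \<sqsubseteq>\<^bsub>K\<^esub> z" if "x \<in> carrier K" "y \<in> carrier K" "z \<in> carrier K" "x \<sqsubseteq>\<^bsub>K\<^esub> y" "y \<sqsubseteq>\<^bsub>K\<^esub> z" for x y z
      using that by (auto simp: cK le dest: H.le_trans[OF _ _ SH SH SH])
    have bc: "e \<bottom>\<^bsub>H\<^esub> \<in> carrier K"
      by (simp add: cK)
    have bl: "e \<bottom>\<^bsub>H\<^esub> \<sqsubseteq>\<^bsub>K\<^esub> x" if "x \<in> carrier K" for x
      using that by (auto simp: cK le SH)
    have tc: "e \<top>\<^bsub>H\<^esub> \<in> carrier K"
      by (simp add: cK)
    have tl: "x \<sqsubseteq>\<^bsub>K\<^esub> e \<top>\<^bsub>H\<^esub>" if "x \<in> carrier K" for x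
      using that by (auto simp: cK le SH)
    have mc: "e (?d x \<sqinter>\<^bsub>H\<^esub> ?d y) \<in> carrier K" if "x \<in> carrier K" "y \<in> carrier K" for x y
      using that by (auto simp: cK)
    have ml: "w \<sqsubseteq>\<^bsub>K\<^esub> e (?d x \<sqinter>\<^bsub>H\<^esub> ?d y) \<longleftrightarrow> w \<sqsubseteq>\<^bsub>K\<^esub> x \<and> w \<sqsubseteq>\<^bsub>K\<^esub> y" if "w \<in> carrier K" "x \<in> carrier K" "y \<in> carrier K" for w x y
      using that by (auto simp: cK le m)
    have jc: "e (?d x \<squnion>\<^bsub>H\<^esub> ?d y) \<in> carrier K" if "x \<in> carrier K" "y \<in> carrier K" for x y
      using that by (auto simp: cK)
    have jl: "e (?d x \<squnion>\<^bsub>H\<^esub> ?d y) \<sqsubseteq>\<^bsub>K\<^esub> w \<longleftrightarrow> x \<sqsubseteq>\<^bsub>K\<^esub> w \<and> y \<sqsubseteq>\<^bsub>K\<^esub> w" if "w \<in> carrier K" "x \<in> carrier K" "y \<in> carrier K" for w x y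
      using that by (auto simp: cK le j)
    have ic: "e (?d x \<leadsto>\<^bsub>H\<^esub> ?d y) \<in> carrier K" if "x \<in> carrier K" "y \<in> carrier K" for x y
      using that by (auto simp: cK)
    have il: "w \<sqsubseteq>\<^bsub>K\<^esub> e (?d x \<leadsto>\<^bsub>H\<^esub> ?d y) \<longleftrightarrow> e (?d w \<sqinter>\<^bsub>H\<^esub> ?d x) \<sqsubseteq>\<^bsub>K\<^esub> y" if "w \<in> carrier K" "x \<in> carrier K" "y \<in> carrier K" for w x y
      using that by (auto simp: cK le i)
    have pl: "e \<top>\<^bsub>H\<^esub> \<sqsubseteq>\<^bsub>K\<^esub> e (?d (e (?d x \<leadsto>\<^bsub>H\<^esub> ?d y)) \<squnion>\<^bsub>H\<^esub> ?d (e (?d y \<leadsto>\<^bsub>H\<^esub> ?d x)))" if "x \<in> carrier K" "y \<in> carrier K" for x y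
      using that by (auto simp: cK le SH H.prelinear)
    note K' = godel_algebraI[of K, OF eK R A T bc bl tc tl mc ml jc jl ic il pl]
    show ?thesis by (intro conjI ballI K')
  qed
  then show KG: "godel_algebra K" by blast
  show "?d \<in> godel_hom K H"
    using KG H by (rule godel_homI) (use KK SH in \<open>auto simp: K_def\<close>)
qed

lemma godel_hom_inv_into:
  assumes K: "godel_algebra K" and d: "inv_into S e \<in> godel_hom K H" and S: "carrier K = e ` S"
    and F: "godel_algebra F" and f: "f \<in> godel_hom F H" and fS: "\<And>x. x \<in> carrier F \<Longrightarrow> f x \<in> S"
    and e: "inj_on e S"
  shows "(\<lambda>x. e (f x)) \<in> godel_hom F K"
proof -
  interpret F: godel_algebra F by fact
  interpret K: godel_algebra K by fact
  have df [simp]: "inv_into S e (e (f x)) = f x" if "x \<in> carrier F" for x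
    using that e fS by simp
  have eK [simp]: "e (f x) \<in> carrier K" if "x \<in> carrier F" for x
    using that fS S by blast
  have eq: "e z = y" if "y \<in> carrier K" "inv_into S e y = z" for y z
    using that S by (auto simp: f_inv_into_f)
  show ?thesis
    using F K
    by (rule godel_homI) (auto intro!: eq simp: godel_homD[OF f] godel_homD[OF d])
qed

lemma godel_hom_eq_on_generated:
  assumes G: "godel_algebra G" and X: "X \<subseteq> carrier G"
    and f: "f \<in> godel_hom G H" and g: "g \<in> godel_hom G H"
    and eq: "\<And>x. x \<in> X \<Longrightarrow> f x = g x" and x: "x \<in> generated G X"
  shows "f x = g x"
proof -
  have "x \<in> generated G X \<Longrightarrow> x \<in> carrier G" for x
    using generated_subset[OF G X] by blast
  with x show ?thesis
    by induction (simp_all add: eq godel_homD[OF f] godel_homD[OF g])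
qed


subsection \<open>Terms\<close>

datatype 'x gterm = Gen 'x | Bot | Top
  | Meet "'x gterm" "'x gterm" | Join "'x gterm" "'x gterm" | Imp "'x gterm" "'x gterm"

primrec tval :: "'k gorder \<Rightarrow> ('x \<Rightarrow> 'k) \<Rightarrow> 'x gterm \<Rightarrow> 'k" where
  "tval H v (Gen x) = v x"
| "tval H v Bot = \<bottom>\<^bsub>H\<^esub>"
| "tval H v Top = \<top>\<^bsub>H\<^esub>"
| "tval H v (Meet s t) = tval H v s \<sqinter>\<^bsub>H\<^esub> tval H v t"
| "tval H v (Join s t) = tval H v s \<squnion>\<^bsub>H\<^esub> tval H v t"
| "tval H v (Imp s t) = tval H v s \<leadsto>\<^bsub>H\<^esub> tval H v t"

lemma tval_closed:
  assumes "godel_algebra H" "range v \<subseteq> carrier H"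
  shows "tval H v t \<in> carrier H"
proof -
  interpret godel_algebra H by fact
  show ?thesis by (induction t) (use assms(2) in auto)
qed

lemma generated_eq_tval: "generated H (range v) \<subseteq> range (tval H v)"
proof
  fix x assume "x \<in> generated H (range v)"
  then show "x \<in> range (tval H v)"
  proof induction
    case (gen_base x) then show ?case by (auto intro: range_eqI[of _ _ "Gen _"])
  next
    case gen_bot then show ?case by (rule range_eqI[of _ _ Bot]) simp
  next
    case gen_top then show ?case by (rule range_eqI[of _ _ Top]) simp
  next
    case (gen_meet x y) then show ?case by (auto intro: range_eqI[of _ _ "Meet _ _"])
  next
    case (gen_join x y) then show ?case by (auto intro: range_eqI[of _ _ "Join _ _"])
  next
    case (gen_imp x y) then show ?case by (auto intro: range_eqI[of _ _ "Imp _ _"])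
  qed
qed

lemma gterm_inj_list:
  includes cardinal_syntax
  shows "\<exists>c :: 'x gterm \<Rightarrow> 'x list. inj c"
proof -
  have "infinite (UNIV :: 'x list set)" by (rule infinite_UNIV_listI)
  then have "|UNIV \<times> UNIV :: ('x list \<times> 'x list) set| \<le>o |UNIV :: 'x list set|"
    using card_of_Times_same_infinite ordIso_imp_ordLeq by blast
  then obtain p :: "'x list \<times> 'x list \<Rightarrow> 'x list" where "inj p"
    by (auto simp: card_of_ordLeq[symmetric])
  then have p [simp]: "p a = p b \<longleftrightarrow> a = b" for a b by (simp add: inj_eq)
  define r :: "nat \<Rightarrow> 'x list" where "r n = replicate n undefined" for n
  have r [simp]: "r m = r n \<longleftrightarrow> m = n" for m n by (auto simp: r_def)
  define c where "c = rec_gterm (\<lambda>x. p (r 0, [x])) (p (r 1, [])) (p (r 2, []))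
    (\<lambda>_ _ a b. p (r 3, p (a, b))) (\<lambda>_ _ a b. p (r 4, p (a, b))) (\<lambda>_ _ a b. p (r 5, p (a, b)))"
  have "c s = c t \<Longrightarrow> s = t" for s t
  proof (induction s arbitrary: t)
    case (Gen x) then show ?case by (cases t) (auto simp: c_def)
  next
    case Bot then show ?case by (cases t) (auto simp: c_def)
  next
    case Top then show ?case by (cases t) (auto simp: c_def)
  next
    case (Meet s1 s2) then show ?case by (cases t) (auto simp: c_def)
  next
    case (Join s1 s2) then show ?case by (cases t) (auto simp: c_def)
  next
    case (Imp s1 s2) then show ?case by (cases t) (auto simp: c_def)
  qed
  then show ?thesis by (auto simp: inj_def)
qed


subsection \<open>The universal property over every type\<close>

lemma is_coproduct_generated:
  fixes C :: "'c gorder" and G :: "'i \<Rightarrow> 'a gorder"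
  assumes C: "is_coproduct I G C \<iota>" and G: "\<And>i. i \<in> I \<Longrightarrow> godel_algebra (G i)"
  shows "generated C (\<Union>i\<in>I. \<iota> i ` carrier (G i)) = carrier C"
proof -
  define X where "X = (\<Union>i\<in>I. \<iota> i ` carrier (G i))"
  define S where "S = generated C X"
  define e :: "'c \<Rightarrow> 'c + ('i \<times> 'a) list" where "e = Inl"
  have Cg: "godel_algebra C" and \<iota>: "\<And>i. i \<in> I \<Longrightarrow> \<iota> i \<in> godel_hom (G i) C"
    and univ: "\<And>(H :: ('c + ('i \<times> 'a) list) gorder) f. godel_algebra H \<Longrightarrow>
      (\<And>i. i \<in> I \<Longrightarrow> f i \<in> godel_hom (G i) H) \<Longrightarrow>
      \<exists>!h. h \<in> godel_hom C H \<and> h \<in> extensional (carrier C) \<and>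
            (\<forall>i\<in>I. \<forall>x\<in>carrier (G i). h (\<iota> i x) = f i x)"
    using C unfolding is_coproduct_def is_coproduct_wrt_def by blast+
  interpret C: godel_algebra C by fact
  have X: "X \<subseteq> carrier C" using godel_homD(2)[OF \<iota>] by (auto simp: X_def)
  have SC: "S \<subseteq> carrier C" unfolding S_def by (rule generated_subset[OF Cg X])
  have CC: "generated C (carrier C) = carrier C"
    using generated_subset[OF Cg order_refl] by (auto intro: generated.gen_base)
  have XS: "\<iota> i x \<in> S" if "i \<in> I" "x \<in> carrier (G i)" for i x
    using that unfolding S_def X_def by (blast intro: generated.gen_base)
  have injS: "inj_on e (generated C X)" and injC: "inj_on e (generated C (carrier C))"
    by (auto simp: e_def)
  define K :: "('c + ('i \<times> 'a) list) gorder"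
    where "K = \<lparr>carrier = e ` S, eq = (=),
                 le = (\<lambda>x y. inv_into S e x \<sqsubseteq>\<^bsub>C\<^esub> inv_into S e y)\<rparr>"
  note K = generated_copy[OF Cg X injS, folded S_def, folded K_def]
  have cK: "carrier K = e ` S" by (simp add: K_def)
  define D :: "('c + ('i \<times> 'a) list) gorder"
    where "D = \<lparr>carrier = e ` carrier C, eq = (=),
                 le = (\<lambda>x y. inv_into (carrier C) e x \<sqsubseteq>\<^bsub>C\<^esub> inv_into (carrier C) e y)\<rparr>"
  note D = generated_copy[OF Cg order_refl injC, unfolded CC, folded D_def]
  have cD: "carrier D = e ` carrier C" by (simp add: D_def)
  have "(\<lambda>x. e (\<iota> i x)) \<in> godel_hom (G i) K" if "i \<in> I" for i
    by (rule godel_hom_inv_into[OF K cK G[OF that] \<iota>[OF that] XS[OF that] injS[folded S_def]])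
  from univ[OF K(1) this] obtain u where u: "u \<in> godel_hom C K"
    and u\<iota>: "\<And>i x. \<lbrakk>i \<in> I; x \<in> carrier (G i)\<rbrakk> \<Longrightarrow> u (\<iota> i x) = e (\<iota> i x)" by blast
  define w where "w = (\<lambda>x. inv_into S e (u x))"
  have w: "w \<in> godel_hom C C"
    unfolding w_def by (rule godel_hom_comp[OF u K(2) Cg Cg])
  have wS: "w x \<in> S" if "x \<in> carrier C" for x
    using godel_homD(2)[OF u that] unfolding w_def K_def by (auto intro: inv_into_into)
  have w\<iota>: "w (\<iota> i x) = \<iota> i x" if "i \<in> I" "x \<in> carrier (G i)" for i x
    using that XS[OF that] by (simp add: w_def u\<iota> e_def)
  define h1 where "h1 = restrict (\<lambda>x. e (w x)) (carrier C)"
  define h2 where "h2 = restrict e (carrier C)"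
  have idC: "(\<lambda>x. x) \<in> godel_hom C C" by (rule godel_homI[OF Cg Cg]) auto
  have h1: "h1 \<in> godel_hom C D"
    by (rule godel_hom_cong[OF godel_hom_inv_into[OF D cD Cg w _ injC[unfolded CC]] Cg D(1)]) (use godel_homD(2)[OF w] in \<open>auto simp: h1_def\<close>)
  have h2: "h2 \<in> godel_hom C D"
    by (rule godel_hom_cong[OF godel_hom_inv_into[OF D cD Cg idC _ injC[unfolded CC]] Cg D(1)]) (auto simp: h2_def)
  have "(\<lambda>x. e (\<iota> i x)) \<in> godel_hom (G i) D" if "i \<in> I" for i
    by (rule godel_hom_inv_into[OF D cD G[OF that] \<iota>[OF that] godel_homD(2)[OF \<iota>[OF that]] injC[unfolded CC]])
  from univ[OF D(1) this] have "h1 = h2"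
    using h1 h2 godel_homD(2)[OF \<iota>] w\<iota> unfolding h1_def h2_def
    by (smt (verit) restrict_apply' restrict_extensional)
  have "x \<in> S" if "x \<in> carrier C" for x
  proof -
    have "w x = x" using fun_cong[OF \<open>h1 = h2\<close>, of x] that by (simp add: h1_def h2_def e_def)
    with wS[OF that] show ?thesis by simp
  qed
  with SC show ?thesis unfolding S_def X_def by blast
qed

theorem is_coproduct_imp_wrt:
  fixes C :: "'c gorder" and G :: "'i \<Rightarrow> 'a gorder"
  assumes C: "is_coproduct I G C \<iota>" and G: "\<And>i. i \<in> I \<Longrightarrow> godel_algebra (G i)"
  shows "is_coproduct_wrt TYPE('k) I G C \<iota>"
proof -
  define X where "X = (\<Union>i\<in>I. \<iota> i ` carrier (G i))"
  have Cg: "godel_algebra C" and \<iota>: "\<And>i. i \<in> I \<Longrightarrow> \<iota> i \<in> godel_hom (G i) C"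
    and univ: "\<And>(H :: ('c + ('i \<times> 'a) list) gorder) f. godel_algebra H \<Longrightarrow>
      (\<And>i. i \<in> I \<Longrightarrow> f i \<in> godel_hom (G i) H) \<Longrightarrow>
      \<exists>!h. h \<in> godel_hom C H \<and> h \<in> extensional (carrier C) \<and>
            (\<forall>i\<in>I. \<forall>x\<in>carrier (G i). h (\<iota> i x) = f i x)"
    using C unfolding is_coproduct_def is_coproduct_wrt_def by blast+
  interpret C: godel_algebra C by fact
  have X: "X \<subseteq> carrier C" using godel_homD(2)[OF \<iota>] by (auto simp: X_def)
  have gen: "generated C X = carrier C"
    unfolding X_def by (rule is_coproduct_generated[OF C G])
  have "\<exists>!h. h \<in> godel_hom C H \<and> h \<in> extensional (carrier C) \<and>
            (\<forall>i\<in>I. \<forall>x\<in>carrier (G i). h (\<iota> i x) = f i x)"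
    if H: "godel_algebra H" and f: "\<And>i. i \<in> I \<Longrightarrow> f i \<in> godel_hom (G i) H"
    for H :: "'k gorder" and f
  proof (rule ex_ex1I)
    interpret H: godel_algebra H by fact
    define v where "v = (\<lambda>(i, x). if i \<in> I \<and> x \<in> carrier (G i) then f i x else \<bottom>\<^bsub>H\<^esub>)"
    have v: "range v \<subseteq> carrier H" using godel_homD(2)[OF f] by (auto simp: v_def)
    obtain c :: "('i \<times> 'a) gterm \<Rightarrow> ('i \<times> 'a) list" where c: "inj c"
      using gterm_inj_list by blast
    define S where "S = generated H (range v)"
    define e :: "'k \<Rightarrow> 'c + ('i \<times> 'a) list" where "e = (\<lambda>x. Inr (c (inv (tval H v) x)))"
    have e: "inj_on e (generated H (range v))"
    proof (rule inj_onI)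
      fix x y assume "x \<in> generated H (range v)" "y \<in> generated H (range v)" "e x = e y"
      then show "x = y"
        using generated_eq_tval[of H v] c unfolding e_def
        by (metis (no_types, lifting) f_inv_into_f injD sum.inject(2) subsetD)
    qed
    define K :: "('c + ('i \<times> 'a) list) gorder"
    where "K = \<lparr>carrier = e ` S, eq = (=),
                 le = (\<lambda>x y. inv_into S e x \<sqsubseteq>\<^bsub>H\<^esub> inv_into S e y)\<rparr>"
    note K = generated_copy[OF H v e, folded S_def, folded K_def]
  have cK: "carrier K = e ` S" by (simp add: K_def)
    have vS: "f i x \<in> S" if "i \<in> I" "x \<in> carrier (G i)" for i x
    proof -
      have "f i x = v (i, x)" using that by (simp add: v_def)
      then show ?thesis unfolding S_def by (simp add: generated.gen_base)
    qed
    have "(\<lambda>x. e (f i x)) \<in> godel_hom (G i) K" if "i \<in> I" for i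
      by (rule godel_hom_inv_into[OF K cK G[OF that] f[OF that] vS[OF that] e[folded S_def]])
    from univ[OF K(1) this] obtain u where u: "u \<in> godel_hom C K"
      and u\<iota>: "\<And>i x. \<lbrakk>i \<in> I; x \<in> carrier (G i)\<rbrakk> \<Longrightarrow> u (\<iota> i x) = e (f i x)" by blast
    define h where "h = restrict (\<lambda>x. inv_into S e (u x)) (carrier C)"
    have "h \<in> godel_hom C H"
      by (rule godel_hom_cong[OF godel_hom_comp[OF u K(2) Cg H] Cg H]) (simp add: h_def)
    moreover have "h (\<iota> i x) = f i x" if "i \<in> I" "x \<in> carrier (G i)" for i x
      using that vS[OF that] godel_homD(2)[OF \<iota>] e by (simp add: h_def u\<iota> S_def)
    ultimately show "\<exists>h. h \<in> godel_hom C H \<and> h \<in> extensional (carrier C) \<and>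
            (\<forall>i\<in>I. \<forall>x\<in>carrier (G i). h (\<iota> i x) = f i x)"
      unfolding h_def by blast
  next
    fix h h'
    assume h: "h \<in> godel_hom C H \<and> h \<in> extensional (carrier C) \<and>
            (\<forall>i\<in>I. \<forall>x\<in>carrier (G i). h (\<iota> i x) = f i x)"
      and h': "h' \<in> godel_hom C H \<and> h' \<in> extensional (carrier C) \<and>
            (\<forall>i\<in>I. \<forall>x\<in>carrier (G i). h' (\<iota> i x) = f i x)"
    have "h x = h' x" if "x \<in> carrier C" for x
      by (rule godel_hom_eq_on_generated[OF Cg X, of _ H])
         (use h h' that gen in \<open>auto simp: X_def\<close>)
    then show "h = h'" using h h' by (blast intro: extensionalityI)
  qed
  then show ?thesis
    using Cg \<iota> unfolding is_coproduct_wrt_def by blast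
qed


subsection \<open>Existence\<close>

text \<open>
  Entailment between terms over the disjoint union of the \<open>G i\<close>; the coproduct is the
  quotient by mutual entailment. Pairs outside the disjoint union are collapsed to bottom.
\<close>

inductive entails :: "'i set \<Rightarrow> ('i \<Rightarrow> 'a gorder) \<Rightarrow> ('i \<times> 'a) gterm \<Rightarrow> ('i \<times> 'a) gterm \<Rightarrow> bool"
  for I :: "'i set" and G :: "'i \<Rightarrow> 'a gorder" where
    ent_refl: "entails I G s s"
  | ent_trans: "\<lbrakk>entails I G s t; entails I G t u\<rbrakk> \<Longrightarrow> entails I G s u"
  | ent_botE: "entails I G Bot s"
  | ent_topI: "entails I G s Top"
  | ent_meetE1: "entails I G (Meet s t) s"
  | ent_meetE2: "entails I G (Meet s t) t"
  | ent_meetI: "\<lbrakk>entails I G u s; entails I G u t\<rbrakk> \<Longrightarrow> entails I G u (Meet s t)"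
  | ent_joinI1: "entails I G s (Join s t)"
  | ent_joinI2: "entails I G t (Join s t)"
  | ent_joinE: "\<lbrakk>entails I G s u; entails I G t u\<rbrakk> \<Longrightarrow> entails I G (Join s t) u"
  | ent_impI: "entails I G (Meet u s) t \<Longrightarrow> entails I G u (Imp s t)"
  | ent_impE: "entails I G u (Imp s t) \<Longrightarrow> entails I G (Meet u s) t"
  | ent_prelin: "entails I G Top (Join (Imp s t) (Imp t s))"
  | ent_junk: "\<not> (i \<in> I \<and> x \<in> carrier (G i)) \<Longrightarrow> entails I G (Gen (i, x)) Bot"
  | ent_gbot: "i \<in> I \<Longrightarrow> entails I G (Gen (i, \<bottom>\<^bsub>G i\<^esub>)) Bot"
  | ent_gtop: "i \<in> I \<Longrightarrow> entails I G Top (Gen (i, \<top>\<^bsub>G i\<^esub>))"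
  | ent_gmeet: "\<lbrakk>i \<in> I; x \<in> carrier (G i); y \<in> carrier (G i)\<rbrakk>
      \<Longrightarrow> entails I G (Meet (Gen (i, x)) (Gen (i, y))) (Gen (i, x \<sqinter>\<^bsub>G i\<^esub> y))"
  | ent_gmeet': "\<lbrakk>i \<in> I; x \<in> carrier (G i); y \<in> carrier (G i)\<rbrakk>
      \<Longrightarrow> entails I G (Gen (i, x \<sqinter>\<^bsub>G i\<^esub> y)) (Meet (Gen (i, x)) (Gen (i, y)))"
  | ent_gjoin: "\<lbrakk>i \<in> I; x \<in> carrier (G i); y \<in> carrier (G i)\<rbrakk>
      \<Longrightarrow> entails I G (Join (Gen (i, x)) (Gen (i, y))) (Gen (i, x \<squnion>\<^bsub>G i\<^esub> y))"
  | ent_gjoin': "\<lbrakk>i \<in> I; x \<in> carrier (G i); y \<in> carrier (G i)\<rbrakk>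
      \<Longrightarrow> entails I G (Gen (i, x \<squnion>\<^bsub>G i\<^esub> y)) (Join (Gen (i, x)) (Gen (i, y)))"
  | ent_gimp: "\<lbrakk>i \<in> I; x \<in> carrier (G i); y \<in> carrier (G i)\<rbrakk>
      \<Longrightarrow> entails I G (Imp (Gen (i, x)) (Gen (i, y))) (Gen (i, x \<leadsto>\<^bsub>G i\<^esub> y))"
  | ent_gimp': "\<lbrakk>i \<in> I; x \<in> carrier (G i); y \<in> carrier (G i)\<rbrakk>
      \<Longrightarrow> entails I G (Gen (i, x \<leadsto>\<^bsub>G i\<^esub> y)) (Imp (Gen (i, x)) (Gen (i, y)))"

lemma entails_sound:
  assumes H: "godel_algebra H" and G: "\<And>i. i \<in> I \<Longrightarrow> godel_algebra (G i)"
    and f: "\<And>i. i \<in> I \<Longrightarrow> f i \<in> godel_hom (G i) H"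
    and v: "v = (\<lambda>(i, x). if i \<in> I \<and> x \<in> carrier (G i) then f i x else \<bottom>\<^bsub>H\<^esub>)"
    and st: "entails I G s t"
  shows "tval H v s \<sqsubseteq>\<^bsub>H\<^esub> tval H v t"
proof -
  interpret H: godel_algebra H by fact
  have vc: "range v \<subseteq> carrier H" using godel_homD(2)[OF f] by (auto simp: v)
  have tc [simp]: "tval H v s \<in> carrier H" for s
    by (rule tval_closed[OF H vc])
  have Gc: "\<bottom>\<^bsub>G i\<^esub> \<in> carrier (G i)" "\<top>\<^bsub>G i\<^esub> \<in> carrier (G i)"
    "\<And>x y. \<lbrakk>x \<in> carrier (G i); y \<in> carrier (G i)\<rbrakk> \<Longrightarrow> x \<sqinter>\<^bsub>G i\<^esub> y \<in> carrier (G i)"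
    "\<And>x y. \<lbrakk>x \<in> carrier (G i); y \<in> carrier (G i)\<rbrakk> \<Longrightarrow> x \<squnion>\<^bsub>G i\<^esub> y \<in> carrier (G i)"
    "\<And>x y. \<lbrakk>x \<in> carrier (G i); y \<in> carrier (G i)\<rbrakk> \<Longrightarrow> x \<leadsto>\<^bsub>G i\<^esub> y \<in> carrier (G i)"
    if "i \<in> I" for i
  proof -
    interpret G: godel_algebra "G i" by (rule G) fact
    show "\<bottom>\<^bsub>G i\<^esub> \<in> carrier (G i)" "\<top>\<^bsub>G i\<^esub> \<in> carrier (G i)"
    "\<And>x y. \<lbrakk>x \<in> carrier (G i); y \<in> carrier (G i)\<rbrakk> \<Longrightarrow> x \<sqinter>\<^bsub>G i\<^esub> y \<in> carrier (G i)"
    "\<And>x y. \<lbrakk>x \<in> carrier (G i); y \<in> carrier (G i)\<rbrakk> \<Longrightarrow> x \<squnion>\<^bsub>G i\<^esub> y \<in> carrier (G i)"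
    "\<And>x y. \<lbrakk>x \<in> carrier (G i); y \<in> carrier (G i)\<rbrakk> \<Longrightarrow> x \<leadsto>\<^bsub>G i\<^esub> y \<in> carrier (G i)"
      by auto
  qed
  have vf: "v (i, x) = f i x" if "i \<in> I" "x \<in> carrier (G i)" for i x
    using that by (simp add: v)
  have fc: "f i x \<in> carrier H" if "i \<in> I" "x \<in> carrier (G i)" for i x
    using godel_homD(2)[OF f] that by blast
  from st show ?thesis
  proof induction
    case (ent_trans s t u) then show ?case by (meson H.le_trans tc)
  next
    case (ent_meetI u s t) then show ?case by (simp add: H.meet_le)
  next
    case (ent_joinE s u t) then show ?case by (simp add: H.join_le)
  next
    case (ent_impI u s t) then show ?case by (simp add: H.heyting_imp_iff)
  next
    case (ent_impE u s t) then show ?case by (simp add: H.heyting_imp_iff)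
  next
    case (ent_prelin s t) then show ?case by (simp add: H.prelinear)
  next
    case (ent_junk i x) then show ?case by (auto simp: v)
  qed (simp_all add: H.meet_left H.meet_right H.join_left H.join_right vf Gc fc godel_homD[OF f])
qed

theorem is_coproduct_exists:
  fixes G :: "'i \<Rightarrow> 'a gorder"
  assumes G: "\<And>i. i \<in> I \<Longrightarrow> godel_algebra (G i)"
  shows "\<exists>(C :: ('i \<times> 'a) gterm set gorder) \<iota>. is_coproduct I G C \<iota>"
proof -
  let ?E = "entails I G"
  define q where "q s = {t. ?E s t \<and> ?E t s}" for s
  have qI: "s \<in> q s" for s by (simp add: q_def entails.ent_refl)
  have qeq: "q s = q t \<longleftrightarrow> ?E s t \<and> ?E t s" for s t
  proof
    assume "q s = q t"
    then show "?E s t \<and> ?E t s" using qI[of t] by (auto simp: q_def)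
  next
    assume "?E s t \<and> ?E t s"
    then show "q s = q t" by (auto simp: q_def intro: entails.ent_trans)
  qed
  define r where "r A = (SOME s. q s = A)" for A
  have qr: "q (r (q s)) = q s" for s
    unfolding r_def by (rule someI[where P = "\<lambda>t. q t = q s"]) simp
  have r1: "?E (r (q s)) s" and r2: "?E s (r (q s))" for s
    using qr[of s] by (auto simp: qeq)
  define C :: "('i \<times> 'a) gterm set gorder"
    where "C = \<lparr>carrier = range q, eq = (=), le = (\<lambda>A B. ?E (r A) (r B))\<rparr>"
  have carr: "carrier C = range q" and Ceq: "eq C = (=)" by (simp_all add: C_def)
  have le: "q s \<sqsubseteq>\<^bsub>C\<^esub> q t \<longleftrightarrow> ?E s t" for s t
    by (simp add: C_def) (meson r1 r2 entails.ent_trans)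
  have m: "?E w (Meet s t) \<longleftrightarrow> ?E w s \<and> ?E w t" for w s t
    by (meson entails.intros)
  have j: "?E (Join s t) w \<longleftrightarrow> ?E s w \<and> ?E t w" for w s t
    by (meson entails.intros)
  have i: "?E w (Imp s t) \<longleftrightarrow> ?E (Meet w s) t" for w s t
    by (meson entails.intros)
  have mq: "q (Meet (r (q s)) (r (q t))) = q (Meet s t)" for s t
    unfolding qeq by (meson entails.intros r1 r2)
  have jq: "q (Join (r (q s)) (r (q t))) = q (Join s t)" for s t
    unfolding qeq by (meson entails.intros r1 r2)
  have imono: "?E (Imp s t) (Imp s' t')" if "?E s' s" "?E t t'" for s t s' t'
  proof -
    have "?E (Meet (Imp s t) s') (Meet (Imp s t) s)" using that by (meson entails.intros)
    moreover have "?E (Meet (Imp s t) s) t" by (meson entails.intros)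
    ultimately show ?thesis using that by (meson entails.intros)
  qed
  have iq: "q (Imp (r (q s)) (r (q t))) = q (Imp s t)" for s t
    unfolding qeq using imono r1 r2 by blast
  have LL: "godel_algebra C \<and> \<bottom>\<^bsub>C\<^esub> = q Bot \<and> \<top>\<^bsub>C\<^esub> = q Top \<and>
    (\<forall>x\<in>carrier C. \<forall>y\<in>carrier C. x \<sqinter>\<^bsub>C\<^esub> y = q (Meet (r x) (r y)) \<and>
       x \<squnion>\<^bsub>C\<^esub> y = q (Join (r x) (r y)) \<and> x \<leadsto>\<^bsub>C\<^esub> y = q (Imp (r x) (r y)))"
  proof -
    have E: "x = q (r x)" if "x \<in> carrier C" for x using that qr by (auto simp: carr)
    have le': "x \<sqsubseteq>\<^bsub>C\<^esub> y \<longleftrightarrow> ?E (r x) (r y)" for x y by (simp add: C_def)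
    have qc: "q s \<in> carrier C" for s by (simp add: carr)
    have rE: "?E (r (q s)) t \<longleftrightarrow> ?E s t" "?E t (r (q s)) \<longleftrightarrow> ?E t s" for s t
      by (meson r1 r2 entails.ent_trans)+
    have P: "?E Top (Join (r (q (Imp s t))) (r (q (Imp t s))))" for s t
      by (rule entails.ent_trans[OF entails.ent_prelin], rule entails.ent_joinE)
         (rule entails.ent_trans[OF r2], rule entails.ent_joinI1 entails.ent_joinI2)+
    have R: "x \<sqsubseteq>\<^bsub>C\<^esub> x" if "x \<in> carrier C" for x
      by (simp add: le' entails.ent_refl)
    have A: "x = y" if "x \<in> carrier C" "y \<in> carrier C" "x \<sqsubseteq>\<^bsub>C\<^esub> y" "y \<sqsubseteq>\<^bsub>C\<^esub> x" for x y
      using that E[of x] E[of y] by (metis le' qeq)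
    have T: "x \<sqsubseteq>\<^bsub>C\<^esub> z" if "x \<in> carrier C" "y \<in> carrier C" "z \<in> carrier C" "x \<sqsubseteq>\<^bsub>C\<^esub> y" "y \<sqsubseteq>\<^bsub>C\<^esub> z" for x y z
      using that unfolding le' by (blast intro: entails.ent_trans)
    have bc: "q Bot \<in> carrier C"
      by (rule qc)
    have bl: "q Bot \<sqsubseteq>\<^bsub>C\<^esub> x" if "x \<in> carrier C" for x
      by (simp add: le' rE entails.ent_botE)
    have tc: "q Top \<in> carrier C"
      by (rule qc)
    have tl: "x \<sqsubseteq>\<^bsub>C\<^esub> q Top" if "x \<in> carrier C" for x
      by (simp add: le' rE entails.ent_topI)
    have mc: "q (Meet (r x) (r y)) \<in> carrier C" if "x \<in> carrier C" "y \<in> carrier C" for x y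
      by (rule qc)
    have ml: "w \<sqsubseteq>\<^bsub>C\<^esub> q (Meet (r x) (r y)) \<longleftrightarrow> w \<sqsubseteq>\<^bsub>C\<^esub> x \<and> w \<sqsubseteq>\<^bsub>C\<^esub> y" if "w \<in> carrier C" "x \<in> carrier C" "y \<in> carrier C" for w x y
      by (simp add: le' rE m)
    have jc: "q (Join (r x) (r y)) \<in> carrier C" if "x \<in> carrier C" "y \<in> carrier C" for x y
      by (rule qc)
    have jl: "q (Join (r x) (r y)) \<sqsubseteq>\<^bsub>C\<^esub> w \<longleftrightarrow> x \<sqsubseteq>\<^bsub>C\<^esub> w \<and> y \<sqsubseteq>\<^bsub>C\<^esub> w" if "w \<in> carrier C" "x \<in> carrier C" "y \<in> carrier C" for w x y
      by (simp add: le' rE j)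
    have ic: "q (Imp (r x) (r y)) \<in> carrier C" if "x \<in> carrier C" "y \<in> carrier C" for x y
      by (rule qc)
    have il: "w \<sqsubseteq>\<^bsub>C\<^esub> q (Imp (r x) (r y)) \<longleftrightarrow> q (Meet (r w) (r x)) \<sqsubseteq>\<^bsub>C\<^esub> y" if "w \<in> carrier C" "x \<in> carrier C" "y \<in> carrier C" for w x y
      by (simp add: le' rE i)
    have pl: "q Top \<sqsubseteq>\<^bsub>C\<^esub> q (Join (r (q (Imp (r x) (r y)))) (r (q (Imp (r y) (r x)))))" if "x \<in> carrier C" "y \<in> carrier C" for x y
      by (simp add: le' rE P)
    note C' = godel_algebraI[of C, OF Ceq R A T bc bl tc tl mc ml jc jl ic il pl]
    show ?thesis by (intro conjI ballI C')
  qed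
  have Cg: "godel_algebra C" and Cbot: "\<bottom>\<^bsub>C\<^esub> = q Bot" and Ctop: "\<top>\<^bsub>C\<^esub> = q Top"
    using LL by blast+
  have Cmeet: "q s \<sqinter>\<^bsub>C\<^esub> q t = q (Meet s t)" and Cjoin: "q s \<squnion>\<^bsub>C\<^esub> q t = q (Join s t)"
    and Cimp: "q s \<leadsto>\<^bsub>C\<^esub> q t = q (Imp s t)" for s t
    using LL by (auto simp: carr mq jq iq)
  define \<iota> where "\<iota> i x = q (Gen (i, x))" for i x
  have \<iota>c: "\<iota> i \<in> carrier (G i) \<rightarrow> carrier C" for i
    by (simp add: \<iota>_def carr)
  have \<iota>: "\<iota> i \<in> godel_hom (G i) C" if "i \<in> I" for i
    by (rule godel_homI[OF G[OF that] Cg \<iota>c])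
       (simp_all add: that \<iota>_def carr Cbot Ctop Cmeet Cjoin Cimp qeq entails.ent_botE entails.ent_topI entails.ent_gbot
         entails.ent_gtop entails.ent_gmeet entails.ent_gmeet' entails.ent_gjoin entails.ent_gjoin' entails.ent_gimp entails.ent_gimp')
  have univ: "\<exists>!h. h \<in> godel_hom C H \<and> h \<in> extensional (carrier C) \<and>
            (\<forall>i\<in>I. \<forall>x\<in>carrier (G i). h (\<iota> i x) = f i x)"
    if H: "godel_algebra H" and f: "\<And>i. i \<in> I \<Longrightarrow> f i \<in> godel_hom (G i) H"
    for H :: "'k gorder" and f
  proof (rule ex_ex1I)
    interpret H: godel_algebra H by fact
    define v where "v = (\<lambda>(i, x). if i \<in> I \<and> x \<in> carrier (G i) then f i x else \<bottom>\<^bsub>H\<^esub>)"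
    note sound = entails_sound[OF H G f v_def]
    have vc: "range v \<subseteq> carrier H" using godel_homD(2)[OF f] by (auto simp: v_def)
    have tc [simp]: "tval H v s \<in> carrier H" for s
      by (rule tval_closed[OF H vc])
    define h where "h = restrict (\<lambda>A. tval H v (r A)) (carrier C)"
    have hq: "h (q s) = tval H v s" for s
      using sound[OF _ _ r1] sound[OF _ _ r2] by (auto simp: h_def carr intro!: H.le_antisym)
    have "h \<in> godel_hom C H"
      by (rule godel_homI[OF Cg H])
         (auto simp: carr Cbot Ctop Cmeet Cjoin Cimp hq)
    moreover have "h (\<iota> i x) = f i x" if "i \<in> I" "x \<in> carrier (G i)" for i x
      using that by (simp add: \<iota>_def hq v_def)
    ultimately show "\<exists>h. h \<in> godel_hom C H \<and> h \<in> extensional (carrier C) \<and>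
            (\<forall>i\<in>I. \<forall>x\<in>carrier (G i). h (\<iota> i x) = f i x)"
      unfolding h_def by blast
  next
    interpret H: godel_algebra H by fact
    fix h h'
    assume h: "h \<in> godel_hom C H \<and> h \<in> extensional (carrier C) \<and>
            (\<forall>i\<in>I. \<forall>x\<in>carrier (G i). h (\<iota> i x) = f i x)"
      and h': "h' \<in> godel_hom C H \<and> h' \<in> extensional (carrier C) \<and>
            (\<forall>i\<in>I. \<forall>x\<in>carrier (G i). h' (\<iota> i x) = f i x)"
    note hD = godel_homD[OF conjunct1[OF h]] and hD' = godel_homD[OF conjunct1[OF h']]
    have qc [simp]: "q s \<in> carrier C" for s by (simp add: carr)
    have junk: "q (Gen (i, x)) = \<bottom>\<^bsub>C\<^esub>" if "\<not> (i \<in> I \<and> x \<in> carrier (G i))" for i x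
      using entails.ent_junk[of i I x G] that by (simp add: Cbot qeq entails.ent_botE)
    have "h (q s) = h' (q s)" for s
    proof (induction s)
      case (Gen p)
      obtain i x where p: "p = (i, x)" by (cases p)
      show ?case
      proof (cases "i \<in> I \<and> x \<in> carrier (G i)")
        case True then show ?thesis using h h' by (auto simp: p \<iota>_def)
      next
        case False then show ?thesis using junk[OF False] by (simp add: p hD hD')
      qed
    qed (simp_all add: hD hD' Cbot[symmetric] Ctop[symmetric] Cmeet[symmetric]
          Cjoin[symmetric] Cimp[symmetric])
    then have "h x = h' x" if "x \<in> carrier C" for x using that by (auto simp: carr)
    then show "h = h'" using h h' by (blast intro: extensionalityI)
  qed
  have "is_coproduct I G C \<iota>"
    unfolding is_coproduct_def is_coproduct_wrt_def
  proof (intro conjI ballI allI impI)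
    fix H :: "(('i \<times> 'a) gterm set + ('i \<times> 'a) list) gorder" and f
    assume "godel_algebra H \<and> (\<forall>i\<in>I. f i \<in> godel_hom (G i) H)"
    then show "\<exists>!h. h \<in> godel_hom C H \<and> h \<in> extensional (carrier C) \<and>
            (\<forall>i\<in>I. \<forall>x\<in>carrier (G i). h (\<iota> i x) = f i x)"
      by (intro univ) blast+
  qed (rule Cg, erule \<iota>)
  then show ?thesis by blast
qed

end

theory Submission
  imports Defs
begin

text \<open>
  A Goedel algebra has depth greater than \<open>n\<close> iff some homomorphism to a chain takes at least
  \<open>n\<close> values other than bottom and top: such values, in increasing order, refute \<open>bd_n = 1\<close>;
  conversely, a refutation survives in the quotient by a prime filter that omits \<open>bd_n\<close>, and
  that quotient is a chain. A subset of a chain that contains bottom and top is a subalgebra, so the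
  image of the coproduct in a chain is the union of the images of the factors, together with
  bottom and top. This gives the upper bound. For the lower bound, stack chains for the
  individual factors in an ordinal sum that shares bottom and top, and use the universal property.
\<close>

section \<open>Prime filters\<close>

context heyting_algebra
begin

lemma le_imp_iff_top: "\<lbrakk>x \<in> carrier L; y \<in> carrier L\<rbrakk> \<Longrightarrow> x \<sqsubseteq> y \<longleftrightarrow> x \<leadsto> y = \<top>"
proof -
  assume xy: "x \<in> carrier L" "y \<in> carrier L"
  have "\<top> \<sqinter> x = x"
    using xy by (intro le_antisym) (simp_all add: meet_right meet_le)
  then show ?thesis
    using heyting_imp_iff[of "\<top>" x y] xy
    by (metis heyting_imp_closed le_antisym le_refl top_closed top_higher)
qed

lemma meet_le_iff:
  "\<lbrakk>w \<in> carrier L; x \<in> carrier L; y \<in> carrier L\<rbrakk> \<Longrightarrow> w \<sqsubseteq> x \<sqinter> y \<longleftrightarrow> w \<sqsubseteq> x \<and> w \<sqsubseteq> y"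
  by (meson le_trans meet_closed meet_le meet_left meet_right)

lemma join_le_iff:
  "\<lbrakk>w \<in> carrier L; x \<in> carrier L; y \<in> carrier L\<rbrakk> \<Longrightarrow> x \<squnion> y \<sqsubseteq> w \<longleftrightarrow> x \<sqsubseteq> w \<and> y \<sqsubseteq> w"
  by (meson le_trans join_closed join_le join_left join_right)

lemma le_heyting_imp: "\<lbrakk>x \<in> carrier L; y \<in> carrier L\<rbrakk> \<Longrightarrow> y \<sqsubseteq> x \<leadsto> y"
  by (simp add: heyting_imp_iff meet_left)

lemma modus_ponens: "\<lbrakk>x \<in> carrier L; y \<in> carrier L\<rbrakk> \<Longrightarrow> (x \<leadsto> y) \<sqinter> x \<sqsubseteq> y"
  using heyting_imp_iff[of "x \<leadsto> y" x y] by simp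

definition lattice_filter :: "'a set \<Rightarrow> bool"
  where "lattice_filter F \<longleftrightarrow> F \<subseteq> carrier L \<and> \<top> \<in> F \<and>
    (\<forall>x\<in>F. \<forall>y\<in>F. x \<sqinter> y \<in> F) \<and> (\<forall>x\<in>F. \<forall>y\<in>carrier L. x \<sqsubseteq> y \<longrightarrow> y \<in> F)"

lemma lattice_filterD:
  assumes "lattice_filter F"
  shows "F \<subseteq> carrier L" "\<top> \<in> F" "\<lbrakk>x \<in> F; y \<in> F\<rbrakk> \<Longrightarrow> x \<sqinter> y \<in> F"
    "\<lbrakk>x \<in> F; y \<in> carrier L; x \<sqsubseteq> y\<rbrakk> \<Longrightarrow> y \<in> F"
  using assms by (auto simp: lattice_filter_def)

text \<open>This is the filter generated by \<open>F\<close> and \<open>x\<close>: by residuation,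
  \<open>f \<sqinter> x \<sqsubseteq> y\<close> for some \<open>f \<in> F\<close> iff
  \<open>x \<leadsto> y \<in> F\<close>.\<close>

lemma lattice_filter_adjoin:
  assumes F: "lattice_filter F" and x: "x \<in> carrier L"
  shows "lattice_filter {y \<in> carrier L. x \<leadsto> y \<in> F}"
proof -
  have 1: "x \<leadsto> \<top> \<in> F"
    using x lattice_filterD(2)[OF F] le_imp_iff_top[of x \<top>] by simp
  have 2: "x \<leadsto> y \<sqinter> z \<in> F" if "y \<in> carrier L" "z \<in> carrier L" "x \<leadsto> y \<in> F" "x \<leadsto> z \<in> F" for y z
  proof (rule lattice_filterD(4)[OF F lattice_filterD(3)[OF F that(3,4)]])
    let ?m = "(x \<leadsto> y) \<sqinter> (x \<leadsto> z)"
    have m: "?m \<in> carrier L" using x that by simp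
    have "?m \<sqsubseteq> x \<leadsto> y" "?m \<sqsubseteq> x \<leadsto> z" using x that by (simp_all add: meet_left meet_right)
    then show "?m \<sqsubseteq> x \<leadsto> y \<sqinter> z" using x that m by (simp add: heyting_imp_iff meet_le_iff)
  qed (use x that in simp)
  have 3: "x \<leadsto> z \<in> F" if "y \<in> carrier L" "z \<in> carrier L" "x \<leadsto> y \<in> F" "y \<sqsubseteq> z" for y z
  proof (rule lattice_filterD(4)[OF F that(3)])
    have "(x \<leadsto> y) \<sqinter> x \<sqsubseteq> z"
      using modus_ponens[of x y] x that by (meson heyting_imp_closed le_trans meet_closed)
    then show "x \<leadsto> y \<sqsubseteq> x \<leadsto> z" using x that by (simp add: heyting_imp_iff)
  qed (use x that in simp)
  show ?thesis unfolding lattice_filter_def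
  proof (intro conjI ballI impI)
    show "\<top> \<in> {y \<in> carrier L. x \<leadsto> y \<in> F}" using 1 by simp
  next
    fix y z assume "y \<in> {y \<in> carrier L. x \<leadsto> y \<in> F}" "z \<in> {y \<in> carrier L. x \<leadsto> y \<in> F}"
    then show "y \<sqinter> z \<in> {y \<in> carrier L. x \<leadsto> y \<in> F}" using 2[of y z] by simp
  next
    fix y z assume "y \<in> {y \<in> carrier L. x \<leadsto> y \<in> F}" "z \<in> carrier L" "y \<sqsubseteq> z"
    then show "z \<in> {y \<in> carrier L. x \<leadsto> y \<in> F}" using 3[of y z] by simp
  qed auto
qed

text \<open>Zorn's lemma gives a filter maximal among those omitting \<open>a\<close>. It is prime:
  if it missed both \<open>x\<close> and \<open>y\<close>, it would contain
  \<open>x \<leadsto> a\<close> and \<open>y \<leadsto> a\<close>, and together with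
  \<open>x \<squnion> y\<close> these force \<open>a\<close> into it.\<close>

lemma prime_filter_exists:
  assumes a: "a \<in> carrier L" "a \<noteq> \<top>"
  obtains P where "lattice_filter P" "a \<notin> P"
    "\<And>x y. \<lbrakk>x \<in> carrier L; y \<in> carrier L; x \<squnion> y \<in> P\<rbrakk> \<Longrightarrow> x \<in> P \<or> y \<in> P"
proof -
  let ?A = "{F. lattice_filter F \<and> a \<notin> F}"
  have "{\<top>} \<in> ?A"
  proof -
    have "\<top> \<sqinter> \<top> = \<top>" by (intro le_antisym) (simp_all add: meet_left meet_le)
    then show ?thesis using a le_antisym[OF _ top_higher] by (auto simp: lattice_filter_def)
  qed
  moreover have "\<Union>\<C> \<in> ?A" if \<C>: "\<C> \<noteq> {}" "subset.chain ?A \<C>" for \<C>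
  proof -
    have "lattice_filter F" "a \<notin> F" if "F \<in> \<C>" for F
      using \<C> that by (auto simp: subset_chain_def)
    moreover have "x \<sqinter> y \<in> \<Union>\<C>" if "x \<in> F" "y \<in> F'" "F \<in> \<C>" "F' \<in> \<C>" for x y F F'
    proof -
      have "F \<subseteq> F' \<or> F' \<subseteq> F" using \<C> that by (auto simp: subset_chain_def)
      then show ?thesis using that calculation(1) lattice_filterD(3) by (metis UnionI subsetD)
    qed
    ultimately show ?thesis using \<C>(1) unfolding lattice_filter_def by blast
  qed
  ultimately have "\<exists>P\<in>?A. \<forall>F\<in>?A. P \<subseteq> F \<longrightarrow> F = P"
    by (intro subset_Zorn_nonempty) auto
  then obtain P where P: "lattice_filter P" "a \<notin> P"
    and max: "\<And>F. \<lbrakk>lattice_filter F; a \<notin> F; P \<subseteq> F\<rbrakk> \<Longrightarrow> F = P"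
    by auto
  have PC: "z \<in> carrier L" if "z \<in> P" for z using lattice_filterD(1)[OF P(1)] that by blast
  \<comment> \<open>The filter generated by \<open>P\<close> and \<open>x\<close> contains
    \<open>x\<close>, so it differs from \<open>P\<close>; by maximality it must contain
    \<open>a\<close>.\<close>
  have imp_a: "x \<leadsto> a \<in> P" if "x \<in> carrier L" "x \<notin> P" for x
  proof (rule ccontr)
    assume "x \<leadsto> a \<notin> P"
    moreover have "P \<subseteq> {y \<in> carrier L. x \<leadsto> y \<in> P}"
      using that PC by (auto intro: lattice_filterD(4)[OF P(1)] simp: le_heyting_imp)
    ultimately have "{y \<in> carrier L. x \<leadsto> y \<in> P} = P"
      using lattice_filter_adjoin[OF P(1) that(1)] by (intro max) auto
    moreover have "x \<leadsto> x = \<top>" using that le_imp_iff_top[of x x] by simp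
    ultimately show False using that lattice_filterD(2)[OF P(1)] by force
  qed
  have "x \<in> P \<or> y \<in> P" if xy: "x \<in> carrier L" "y \<in> carrier L" "x \<squnion> y \<in> P" for x y
  proof (rule ccontr)
    assume "\<not> (x \<in> P \<or> y \<in> P)"
    then have "x \<leadsto> a \<in> P" "y \<leadsto> a \<in> P" using imp_a xy by auto
    moreover define m where "m = (x \<leadsto> a) \<sqinter> (y \<leadsto> a)"
    ultimately have mP: "m \<in> P" using lattice_filterD(3)[OF P(1)] by simp
    have m: "m \<in> carrier L" "m \<sqsubseteq> x \<leadsto> a" "m \<sqsubseteq> y \<leadsto> a"
      using xy a by (simp_all add: m_def meet_left meet_right)
    \<comment> \<open>Residuating on either side stands in for distributivity: with \<open>m\<close>
      on the right, the bounds on \<open>x\<close> and \<open>y\<close> combine into one on their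
      join.\<close>
    have "z \<sqsubseteq> m \<leadsto> a" if "z \<in> carrier L" "m \<sqsubseteq> z \<leadsto> a" for z
      using that m(1) a by (simp add: heyting_imp_iff meet_comm)
    then have "x \<squnion> y \<sqsubseteq> m \<leadsto> a" using xy m a by (simp add: join_le_iff)
    then have "(x \<squnion> y) \<sqinter> m \<sqsubseteq> a" using xy m a by (simp add: heyting_imp_iff)
    then show False
      using lattice_filterD(3)[OF P(1) xy(3) mP] lattice_filterD(4)[OF P(1)] a P(2) by blast
  qed
  with P show thesis by (rule that)
qed

end


section \<open>Homomorphisms to chains of sets\<close>

text \<open>
  The chain is ordered by inclusion, with bottom \<open>{}\<close> and top \<open>UNIV\<close>; in a chain
  \<open>x \<leadsto> y\<close> is the top if \<open>x \<le> y\<close>, and \<open>y\<close> otherwise.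
\<close>

definition chain_map :: "'a gorder \<Rightarrow> ('a \<Rightarrow> 'b set) \<Rightarrow> bool"
  where "chain_map G h \<longleftrightarrow> h \<bottom>\<^bsub>G\<^esub> = {} \<and> h \<top>\<^bsub>G\<^esub> = UNIV \<and>
    (\<forall>x\<in>carrier G. \<forall>y\<in>carrier G. (h x \<subseteq> h y \<or> h y \<subseteq> h x) \<and>
       h (x \<sqinter>\<^bsub>G\<^esub> y) = h x \<inter> h y \<and> h (x \<squnion>\<^bsub>G\<^esub> y) = h x \<union> h y \<and>
       h (x \<leadsto>\<^bsub>G\<^esub> y) = (if h x \<subseteq> h y then UNIV else h y))"

text \<open>Bottom and top are left out because all factors share them in a coproduct; only the
  other values add up.\<close>

definition mid :: "'a gorder \<Rightarrow> ('a \<Rightarrow> 'b set) \<Rightarrow> 'b set set"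
  where "mid G h = h ` carrier G - {{}, UNIV}"

lemma chain_mapD:
  assumes "chain_map G h"
  shows "h \<bottom>\<^bsub>G\<^esub> = {}" "h \<top>\<^bsub>G\<^esub> = UNIV"
    "\<lbrakk>x \<in> carrier G; y \<in> carrier G\<rbrakk> \<Longrightarrow> h x \<subseteq> h y \<or> h y \<subseteq> h x"
    "\<lbrakk>x \<in> carrier G; y \<in> carrier G\<rbrakk> \<Longrightarrow> h (x \<sqinter>\<^bsub>G\<^esub> y) = h x \<inter> h y"
    "\<lbrakk>x \<in> carrier G; y \<in> carrier G\<rbrakk> \<Longrightarrow> h (x \<squnion>\<^bsub>G\<^esub> y) = h x \<union> h y"
    "\<lbrakk>x \<in> carrier G; y \<in> carrier G\<rbrakk> \<Longrightarrow> h (x \<leadsto>\<^bsub>G\<^esub> y) = (if h x \<subseteq> h y then UNIV else h y)"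
  using assms by (simp_all add: chain_map_def)

text \<open>
  The quotient by the prime filter \<open>P\<close> is a chain, whose elements are represented by
  their sets of strict lower bounds; the top is sent to \<open>UNIV\<close>.
\<close>

lemma chain_map_prime_filter:
  fixes L :: "'a gorder" (structure)
  assumes L: "godel_algebra L" and P: "heyting_algebra.lattice_filter L P" "\<bottom> \<notin> P"
    and prime: "\<And>x y. \<lbrakk>x \<in> carrier L; y \<in> carrier L; x \<squnion> y \<in> P\<rbrakk> \<Longrightarrow> x \<in> P \<or> y \<in> P"
  shows "\<exists>h :: 'a \<Rightarrow> 'a set. chain_map L h \<and> (\<forall>x\<in>carrier L. h x = UNIV \<longleftrightarrow> x \<in> P)"
proof -
  interpret godel_algebra L by fact
  define h where "h = (\<lambda>x. {y. x \<in> P \<or> (y \<in> carrier L \<and> x \<leadsto> y \<notin> P)})"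
  have top: "\<top> \<in> P" by (rule lattice_filterD(2)[OF P(1)])
  have up: "y \<in> P" if "x \<in> P" "x \<sqsubseteq> y" "y \<in> carrier L" for x y
    using lattice_filterD(4)[OF P(1)] that by blast
  have le_P: "x \<leadsto> y \<in> P" if "x \<sqsubseteq> y" "x \<in> carrier L" "y \<in> carrier L" for x y
    using top le_imp_iff_top[of x y] that by simp
  have trans: "x \<leadsto> z \<in> P"
    if "x \<in> carrier L" "y \<in> carrier L" "z \<in> carrier L" "x \<leadsto> y \<in> P" "y \<leadsto> z \<in> P" for x y z
  proof (rule up)
    let ?m = "(x \<leadsto> y) \<sqinter> (y \<leadsto> z)"
    show "?m \<in> P" using that lattice_filterD(3)[OF P(1)] by simp
    have m: "?m \<in> carrier L" "?m \<sqsubseteq> x \<leadsto> y" "?m \<sqsubseteq> y \<leadsto> z"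
      using that by (simp_all add: meet_left meet_right)
    then have "?m \<sqinter> x \<sqsubseteq> y" using that by (simp add: heyting_imp_iff)
    moreover have "?m \<sqinter> x \<sqsubseteq> ?m" using m that by (simp add: meet_left)
    ultimately have "?m \<sqinter> x \<sqsubseteq> ?m \<sqinter> y" using m that by (simp add: meet_le_iff)
    moreover have "?m \<sqinter> y \<sqsubseteq> z" using m that by (simp add: heyting_imp_iff)
    ultimately have "?m \<sqinter> x \<sqsubseteq> z" using m that by (meson le_trans meet_closed)
    then show "?m \<sqsubseteq> x \<leadsto> z" using m that by (simp add: heyting_imp_iff)
  qed (use that in simp)
  have total: "x \<leadsto> y \<in> P \<or> y \<leadsto> x \<in> P" if "x \<in> carrier L" "y \<in> carrier L" for x y
    using prime[of "x \<leadsto> y" "y \<leadsto> x"] that top by (simp add: prelinear)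
  have mp: "y \<in> P" if "x \<leadsto> y \<in> P" "x \<in> P" "y \<in> carrier L" "x \<in> carrier L" for x y
    using up[OF lattice_filterD(3)[OF P(1) that(1,2)] modus_ponens] that by simp
  have UNIV_iff: "h x = UNIV \<longleftrightarrow> x \<in> P" if "x \<in> carrier L" for x
  proof -
    \<comment> \<open>The top is never a strict lower bound, so it witnesses
      \<open>h x \<noteq> UNIV\<close> when \<open>x \<notin> P\<close>.\<close>
    have "\<top> \<in> h x \<longleftrightarrow> x \<in> P" using that le_P[of x \<top>] by (simp add: h_def)
    then show ?thesis by (auto simp: h_def)
  qed
  have sub: "h x \<subseteq> h y \<longleftrightarrow> x \<leadsto> y \<in> P" if xy: "x \<in> carrier L" "y \<in> carrier L" for x y
  proof
    assume "h x \<subseteq> h y"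
    show "x \<leadsto> y \<in> P"
    proof (rule ccontr)
      assume "x \<leadsto> y \<notin> P"
      then have "y \<notin> P" "y \<in> h x" using xy le_heyting_imp up by (auto simp: h_def)
      moreover have "y \<notin> h y" using \<open>y \<notin> P\<close> xy le_P[of y y] by (simp add: h_def)
      ultimately show False using \<open>h x \<subseteq> h y\<close> by blast
    qed
  next
    assume le: "x \<leadsto> y \<in> P"
    show "h x \<subseteq> h y"
    proof
      fix z assume "z \<in> h x"
      then consider "x \<in> P" | "z \<in> carrier L" "x \<leadsto> z \<notin> P" by (auto simp: h_def)
      then show "z \<in> h y"
      proof cases
        case 1 then show ?thesis using mp[OF le] xy by (simp add: h_def)
      next
        case 2 then show ?thesis using trans[OF xy _ le] by (auto simp: h_def)
      qed
    qed
  qed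
  have mono: "h x \<subseteq> h y" if "x \<sqsubseteq> y" "x \<in> carrier L" "y \<in> carrier L" for x y
    using le_P that by (simp add: sub)
  \<comment> \<open>If \<open>x\<close> is below \<open>y\<close> modulo \<open>P\<close>, the meet
    is equivalent to \<open>x\<close>, because
    \<open>x \<leadsto> y \<sqsubseteq> x \<leadsto> x \<sqinter> y\<close>. The counterpart for
    joins is \<open>join1\<close>.\<close>
  have meet1: "h x \<subseteq> h (x \<sqinter> y)" if "h x \<subseteq> h y" "x \<in> carrier L" "y \<in> carrier L" for x y
  proof -
    have "(x \<leadsto> y) \<sqinter> x \<sqsubseteq> x \<sqinter> y" using that by (simp add: meet_le_iff modus_ponens meet_right)
    then have "x \<leadsto> y \<sqsubseteq> x \<leadsto> x \<sqinter> y" using that by (simp add: heyting_imp_iff)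
    then show ?thesis using that up[of "x \<leadsto> y"] by (simp add: sub)
  qed
  have join1: "h (x \<squnion> y) \<subseteq> h y" if "h x \<subseteq> h y" "x \<in> carrier L" "y \<in> carrier L" for x y
  proof -
    have "x \<sqinter> (x \<leadsto> y) \<sqsubseteq> y" "y \<sqinter> (x \<leadsto> y) \<sqsubseteq> y"
      using modus_ponens[of x y] that by (simp_all add: meet_comm[of L x] meet_left)
    then have "x \<sqsubseteq> (x \<leadsto> y) \<leadsto> y" "y \<sqsubseteq> (x \<leadsto> y) \<leadsto> y"
      using that by (simp_all add: heyting_imp_iff)
    then have "x \<squnion> y \<sqsubseteq> (x \<leadsto> y) \<leadsto> y" using that by (simp add: join_le_iff)
    then have "x \<leadsto> y \<sqsubseteq> x \<squnion> y \<leadsto> y"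
      using that by (simp add: heyting_imp_iff meet_comm[of L "x \<squnion> y"])
    then show ?thesis using that up[of "x \<leadsto> y"] by (simp add: sub)
  qed
  have "chain_map L h"
    unfolding chain_map_def
  proof (intro conjI ballI)
    show "h \<bottom> = {}" using P(2) le_P[of \<bottom>] by (auto simp: h_def)
    show "h \<top> = UNIV" using top by (simp add: h_def)
  next
    fix x y assume xy: "x \<in> carrier L" "y \<in> carrier L"
    show tot: "h x \<subseteq> h y \<or> h y \<subseteq> h x" using total xy by (simp add: sub)
    have "h (x \<sqinter> y) \<subseteq> h x" "h (x \<sqinter> y) \<subseteq> h y"
      using mono[of "x \<sqinter> y"] xy by (simp_all add: meet_left meet_right)
    moreover have "h x \<inter> h y \<subseteq> h (x \<sqinter> y)"
      using tot meet1[of x y] meet1[of y x] xy by (auto simp: meet_comm[of L y])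
    ultimately show "h (x \<sqinter> y) = h x \<inter> h y" by blast
    have "h x \<subseteq> h (x \<squnion> y)" "h y \<subseteq> h (x \<squnion> y)"
      using mono[of _ "x \<squnion> y"] xy by (simp_all add: join_left join_right)
    moreover have "h (x \<squnion> y) \<subseteq> h x \<union> h y"
      using tot join1[of x y] join1[of y x] xy by (auto simp: join_comm[of L y])
    ultimately show "h (x \<squnion> y) = h x \<union> h y" by blast
    show "h (x \<leadsto> y) = (if h x \<subseteq> h y then UNIV else h y)"
    proof (cases "h x \<subseteq> h y")
      case True then show ?thesis using xy by (simp add: sub UNIV_iff)
    next
      case False
      have "h y \<subseteq> h (x \<leadsto> y)" using xy by (simp add: mono le_heyting_imp)
      moreover have "h (x \<leadsto> y) \<subseteq> h y"
      proof -
        \<comment> \<open>Contraction: \<open>x \<leadsto> (x \<leadsto> y)\<close> lies below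
          \<open>x \<leadsto> y\<close>. Hence \<open>x \<leadsto> y\<close> is below
          \<open>x\<close> in the quotient, equals its meet with \<open>x\<close> there, and modus
          ponens puts it below \<open>y\<close>.\<close>
        have "\<not> h x \<subseteq> h (x \<leadsto> y)"
        proof
          assume "h x \<subseteq> h (x \<leadsto> y)"
          then have *: "x \<leadsto> (x \<leadsto> y) \<in> P" using xy by (simp add: sub)
          let ?z = "x \<leadsto> (x \<leadsto> y)"
          have z: "?z \<in> carrier L" using xy by simp
          have "?z \<sqinter> x \<sqsubseteq> x \<leadsto> y" using xy by (simp add: modus_ponens)
          moreover have "?z \<sqinter> x \<sqsubseteq> x" using xy by (simp add: meet_right)
          ultimately have "?z \<sqinter> x \<sqsubseteq> (x \<leadsto> y) \<sqinter> x" using xy by (simp add: meet_le_iff)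
          then have "?z \<sqinter> x \<sqsubseteq> y" using xy modus_ponens[of x y] z
            by (meson heyting_imp_closed le_trans meet_closed)
          then have "?z \<sqsubseteq> x \<leadsto> y" using xy z by (simp add: heyting_imp_iff)
          with * False xy up show False by (simp add: sub)
        qed
        then have "h (x \<leadsto> y) \<subseteq> h x" using total[of x "x \<leadsto> y"] xy by (simp add: sub)
        then have "h (x \<leadsto> y) \<subseteq> h ((x \<leadsto> y) \<sqinter> x)" using meet1[of "x \<leadsto> y" x] xy by simp
        also have "\<dots> \<subseteq> h y" using xy by (intro mono modus_ponens) auto
        finally show ?thesis .
      qed
      ultimately show ?thesis using False by auto
    qed
  qed
  with UNIV_iff show ?thesis by blast
qed


section \<open>Depth and chains\<close>

lemma bd_closed:
  assumes "godel_algebra L" "x \<in> UNIV \<rightarrow> carrier L"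
  shows "bd L x n \<in> carrier L"
proof -
  interpret godel_algebra L by fact
  have "x k \<in> carrier L" for k using assms(2) by auto
  then show ?thesis by (induction n) simp_all
qed

lemma bd_cong: "(\<And>k. k \<le> n \<Longrightarrow> x k = y k) \<Longrightarrow> bd L x n = bd L y n"
  by (induction n) simp_all

lemma chain_subset_mid:
  assumes h: "chain_map G h" and A: "A \<subseteq> mid G h"
  shows "subset.chain UNIV A"
proof -
  have "B \<subseteq> B' \<or> B' \<subseteq> B" if "B \<in> A" "B' \<in> A" for B B'
    using that A chain_mapD(3)[OF h] unfolding mid_def by blast
  then show ?thesis by (auto simp: subset_chain_def)
qed

lemma Union_mid_in:
  assumes "chain_map G h" "A \<subseteq> mid G h" "finite A" "A \<noteq> {}"
  shows "\<Union>A \<in> A"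
  using Union_in_chain[OF assms(3,4) chain_subset_mid[OF assms(1,2)]] .

text \<open>The largest member of \<open>A\<close> becomes the value of the last variable. The
  remaining members realize a smaller value \<open>b\<close>, and in a chain
  \<open>a \<leadsto> b = b\<close> for \<open>b\<close> below \<open>a\<close>, so the join is
  \<open>a\<close>. For empty \<open>A\<close> the union is bottom, which is \<open>bd\<close> at
  0.\<close>

lemma bd_realizes_Union:
  assumes G: "godel_algebra G" and h: "chain_map G h"
    and A: "finite A" "A \<subseteq> mid G h" "card A = n"
  shows "\<exists>x \<in> UNIV \<rightarrow> carrier G. h (bd G x n) = \<Union>A"
  using A
proof (induction n arbitrary: A)
  case 0
  interpret godel_algebra G by fact
  from 0 show ?case by (intro bexI[of _ "\<lambda>_. \<bottom>\<^bsub>G\<^esub>"]) (auto simp: chain_mapD[OF h])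
next
  case (Suc n)
  let ?A = "A - {\<Union>A}"
  have "A \<noteq> {}" using Suc.prems(3) by auto
  then have m: "\<Union>A \<in> A" by (rule Union_mid_in[OF h Suc.prems(2,1)])
  then have m': "\<Union>A \<in> h ` carrier G - {{}, UNIV}" using Suc.prems(2) unfolding mid_def by (rule rev_subsetD)
  have "card ?A = n" using Suc.prems m by simp
  then obtain x where x: "x \<in> UNIV \<rightarrow> carrier G" "h (bd G x n) = \<Union>?A"
    using Suc.IH[of ?A] Suc.prems(1,2) by blast
  obtain a where a: "a \<in> carrier G" "h a = \<Union>A" using m' by (metis DiffD1 imageE)
  have "\<Union>A \<noteq> {}" using m' by blast
  \<comment> \<open>The union of a finite nonempty chain is its largest member. So the union of the
    rest is a member other than \<open>\<Union>A\<close>, or empty, whereas members of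
    \<open>mid\<close> are nonempty.\<close>
  have "\<not> \<Union>A \<subseteq> \<Union>?A"
  proof
    assume "\<Union>A \<subseteq> \<Union>?A"
    then have "\<Union>?A = \<Union>A" by blast
    moreover have "?A \<noteq> {}" using calculation \<open>\<Union>A \<noteq> {}\<close> by (metis Union_empty)
    ultimately show False using Union_mid_in[OF h, of ?A] Suc.prems by auto
  qed
  moreover define y where "y = x(Suc n := a)"
  moreover have y: "y \<in> UNIV \<rightarrow> carrier G" using x a by (auto simp: y_def)
  moreover have "bd G y n = bd G x n" by (rule bd_cong) (simp add: y_def)
  ultimately have "h (bd G y (Suc n)) = \<Union>A \<union> \<Union>?A"
    using x a bd_closed[OF G x(1)] heyting_algebra.heyting_imp_closed[of G] G
    by (simp add: chain_mapD[OF h] godel_algebra_def)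
  also have "\<dots> = \<Union>A" by blast
  finally show ?case using y by blast
qed

text \<open>If the value of \<open>bd\<close> is not top, no implication in it evaluates to top. So
  each variable lies strictly above the preceding \<open>bd\<close> value and equals the next one:
  the values of the variables increase strictly between bottom and top.\<close>

lemma chain_below_bd:
  assumes G: "godel_algebra G" and h: "chain_map G h"
    and x: "x \<in> UNIV \<rightarrow> carrier G" and "h (bd G x n) \<noteq> UNIV"
  shows "\<exists>A. finite A \<and> A \<subseteq> mid G h \<and> card A = n \<and> \<Union>A \<subseteq> h (bd G x n)"
  using assms(4)
proof (induction n)
  case 0
  show ?case by (rule exI[of _ "{}"]) simp
next
  case (Suc n)
  let ?b = "bd G x n" and ?x = "x (Suc n)"
  have c: "?b \<in> carrier G" "?x \<in> carrier G" using bd_closed[OF G x] x by auto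
  then have "?x \<leadsto>\<^bsub>G\<^esub> ?b \<in> carrier G"
    using heyting_algebra.heyting_imp_closed[of G] G by (simp add: godel_algebra_def)
  then have E: "h (bd G x (Suc n)) = h ?x \<union> (if h ?x \<subseteq> h ?b then UNIV else h ?b)"
    using c by (simp add: chain_mapD[OF h])
  then have nsub: "\<not> h ?x \<subseteq> h ?b" using Suc.prems by (auto split: if_splits)
  then have sub: "h ?b \<subseteq> h ?x" using chain_mapD(3)[OF h] c by blast
  with E nsub have E: "h (bd G x (Suc n)) = h ?x" by auto
  have "h ?b \<noteq> UNIV" using nsub by auto
  then obtain A where A: "finite A" "A \<subseteq> mid G h" "card A = n" "\<Union>A \<subseteq> h ?b" using Suc.IH by auto
  have "h ?x \<notin> A" using A(4) nsub by blast
  moreover have "h ?x \<in> mid G h" using Suc.prems E nsub c by (auto simp: mid_def)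
  ultimately show ?case
    using A sub unfolding E by (intro exI[of _ "insert (h ?x) A"]) auto
qed

text \<open>The chain may consist of sets over any type, as the ordinal sum in the lower bound
  requires; \<open>chain_map_if_not_GA\<close> returns sets over the type of \<open>G\<close>
  itself.\<close>

lemma not_GA_if_chain_map:
  assumes G: "godel_algebra G" and h: "chain_map G h" and A: "finite A" "A \<subseteq> mid G h" "card A = n"
  shows "G \<notin> GA n"
proof -
  obtain x where x: "x \<in> UNIV \<rightarrow> carrier G" "h (bd G x n) = \<Union>A"
    using bd_realizes_Union[OF assms] by blast
  have "\<Union>A \<noteq> UNIV"
  proof (cases "A = {}")
    case False then show ?thesis using Union_mid_in[OF h A(2,1)] A(2) by (auto simp: mid_def)
  qed simp
  then have "bd G x n \<noteq> \<top>\<^bsub>G\<^esub>" using x chain_mapD(2)[OF h] by auto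
  then show ?thesis using x by (auto simp: GA_def)
qed

text \<open>A prime filter omitting the failing \<open>bd\<close> value also omits bottom, which
  lies below it. The quotient chain keeps that value away from top, so \<open>chain_below_bd\<close>
  applies.\<close>

lemma chain_map_if_not_GA:
  fixes G :: "'a gorder"
  assumes G: "godel_algebra G" and n: "G \<notin> GA n"
  shows "\<exists>(h :: 'a \<Rightarrow> 'a set) A. chain_map G h \<and> finite A \<and> A \<subseteq> mid G h \<and> card A = n"
proof -
  interpret godel_algebra G by fact
  obtain x where x: "x \<in> UNIV \<rightarrow> carrier G" "bd G x n \<noteq> \<top>\<^bsub>G\<^esub>" using n G by (auto simp: GA_def)
  obtain P where P: "lattice_filter P" "bd G x n \<notin> P"
    "\<And>x y. \<lbrakk>x \<in> carrier G; y \<in> carrier G; x \<squnion>\<^bsub>G\<^esub> y \<in> P\<rbrakk> \<Longrightarrow> x \<in> P \<or> y \<in> P"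
    using prime_filter_exists[OF bd_closed[OF G x(1)] x(2)] by blast
  have "\<bottom>\<^bsub>G\<^esub> \<notin> P"
    using lattice_filterD(4)[OF P(1) _ bd_closed[OF G x(1)]] P(2) bd_closed[OF G x(1)] by auto
  then have "\<exists>h :: 'a \<Rightarrow> 'a set. chain_map G h \<and> (\<forall>x\<in>carrier G. h x = UNIV \<longleftrightarrow> x \<in> P)"
    by (rule chain_map_prime_filter[OF G P(1) _ P(3)])
  then obtain h :: "'a \<Rightarrow> 'a set"
    where h: "chain_map G h" "\<forall>x\<in>carrier G. h x = UNIV \<longleftrightarrow> x \<in> P" by blast
  then have "h (bd G x n) \<noteq> UNIV" using bd_closed[OF G x(1)] P(2) by blast
  then obtain A where "finite A" "A \<subseteq> mid G h" "card A = n"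
    using chain_below_bd[OF G h(1) x(1)] by blast
  with h(1) show ?thesis by (intro exI[of _ h] exI[of _ A]) simp
qed

text \<open>On the side of chains this is immediate: a set of \<open>Suc n\<close> intermediate
  values has a subset with \<open>n\<close> elements. It makes the depth a threshold for membership
  in \<open>GA n\<close>.\<close>

lemma GA_Suc:
  assumes "G \<in> GA n" shows "G \<in> GA (Suc n)"
proof (rule ccontr)
  have G: "godel_algebra G" using assms by (simp add: GA_def)
  assume "G \<notin> GA (Suc n)"
  then obtain h :: "'a \<Rightarrow> 'a set" and A
    where h: "chain_map G h" and A: "finite A" "A \<subseteq> mid G h" "card A = Suc n"
    using chain_map_if_not_GA[OF G] by blast
  obtain B where "B \<subseteq> A" "card B = n" using A(3) obtain_subset_with_card_n[of n A] by auto
  moreover have "finite B" using A(1) \<open>B \<subseteq> A\<close> by (rule rev_finite_subset)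
  ultimately show False using not_GA_if_chain_map[OF G h, of B] A assms by blast
qed

lemma GA_mono: "\<lbrakk>m \<le> n; G \<in> GA m\<rbrakk> \<Longrightarrow> G \<in> GA n"
  by (induction rule: dec_induct) (auto intro: GA_Suc)

lemma less_depth_iff: "enat n < depth G \<longleftrightarrow> G \<notin> GA n"
proof (cases "\<exists>m. G \<in> GA m")
  case True
  then have "G \<in> GA (LEAST m. G \<in> GA m)" by (rule LeastI_ex)
  then have "G \<in> GA n \<longleftrightarrow> (LEAST m. G \<in> GA m) \<le> n"
    by (metis GA_mono Least_le)
  then show ?thesis using True by (simp add: depth_def not_le[symmetric])
qed (simp add: depth_def)

lemma less_depth_iff_chain_map:
  fixes G :: "'a gorder"
  assumes "godel_algebra G"
  shows "enat n < depth G \<longleftrightarrow>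
    (\<exists>(h :: 'a \<Rightarrow> 'a set) A. chain_map G h \<and> finite A \<and> A \<subseteq> mid G h \<and> card A = n)"
  unfolding less_depth_iff
  by (intro iffI chain_map_if_not_GA[OF assms]) (auto intro: not_GA_if_chain_map[OF assms, THEN notE])

lemma depth_pos:
  assumes "godel_algebra G" "nontrivial G"
  shows "0 < depth G"
proof -
  interpret godel_algebra G by fact
  have "G \<notin> GA 0" using assms(2) by (auto simp: GA_def nontrivial_def)
  then show ?thesis using less_depth_iff[of 0 G] by (simp add: zero_enat_def)
qed

lemma finite_mid:
  assumes G: "godel_algebra G" and h: "chain_map G h" and d: "depth G = enat d"
  shows "finite (mid G h)" "card (mid G h) \<le> d - 1"
proof -
  have *: "card A < d" if "finite A" "A \<subseteq> mid G h" for A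
    using not_GA_if_chain_map[OF G h that refl] d by (simp flip: less_depth_iff)
  show fin: "finite (mid G h)"
  proof (rule ccontr)
    assume "infinite (mid G h)"
    then obtain A where "finite A" "A \<subseteq> mid G h" "card A = d"
      by (meson infinite_arbitrarily_large)
    with * show False by blast
  qed
  \<comment> \<open>The strict bound \<open>*\<close> makes \<open>d\<close> positive, so the
    subtraction is not truncated.\<close>
  show "card (mid G h) \<le> d - 1" using *[OF fin order_refl] by simp
qed


section \<open>Chain maps and coproducts\<close>

lemma chain_map_comp_hom:
  assumes h: "chain_map H h" and f: "f \<in> godel_hom G H"
  shows "chain_map G (\<lambda>x. h (f x))"
  using godel_homD(2)[OF f] chain_mapD[OF h]
  by (auto simp: chain_map_def godel_homD[OF f])

text \<open>In a chain, meet and join return one of their arguments, and implication returns top or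
  its second argument. Generating therefore adds no value beyond bottom and top.\<close>

lemma chain_map_generated:
  assumes L: "godel_algebra L" and X: "X \<subseteq> carrier L" and h: "chain_map L h"
    and x: "x \<in> generated L X"
  shows "h x \<in> h ` X \<union> {{}, UNIV}"
proof -
  have c: "x \<in> generated L X \<Longrightarrow> x \<in> carrier L" for x
    using generated_subset[OF L X] by blast
  from x show ?thesis
  proof induction
    case (gen_meet x y)
    then have "h (x \<sqinter>\<^bsub>L\<^esub> y) = h x \<or> h (x \<sqinter>\<^bsub>L\<^esub> y) = h y"
      using chain_mapD(3,4)[OF h, of x y] c by auto
    with gen_meet.IH show ?case by metis
  next
    case (gen_join x y)
    then have "h (x \<squnion>\<^bsub>L\<^esub> y) = h x \<or> h (x \<squnion>\<^bsub>L\<^esub> y) = h y"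
      using chain_mapD(3,5)[OF h, of x y] c by auto
    with gen_join.IH show ?case by metis
  next
    case (gen_imp x y) then show ?case using c by (simp add: chain_mapD[OF h])
  qed (simp_all add: chain_mapD[OF h])
qed

lemma mid_coproduct:
  assumes C: "is_coproduct I G C \<iota>" and G: "\<And>i. i \<in> I \<Longrightarrow> godel_algebra (G i)"
    and h: "chain_map C h"
  shows "mid C h \<subseteq> (\<Union>i\<in>I. mid (G i) (\<lambda>x. h (\<iota> i x)))"
proof -
  have Cg: "godel_algebra C" and \<iota>: "\<And>i. i \<in> I \<Longrightarrow> \<iota> i \<in> godel_hom (G i) C"
    using C by (auto simp: is_coproduct_def is_coproduct_wrt_def)
  let ?X = "\<Union>i\<in>I. \<iota> i ` carrier (G i)"
  have X: "?X \<subseteq> carrier C" using godel_homD(2)[OF \<iota>] by auto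
  have "h x \<in> h ` ?X \<union> {{}, UNIV}" if "x \<in> carrier C" for x
    by (rule chain_map_generated[OF Cg X h]) (simp add: is_coproduct_generated[OF C G] that)
  then have "mid C h \<subseteq> h ` ?X - {{}, UNIV}" by (auto simp: mid_def)
  also have "\<dots> \<subseteq> (\<Union>i\<in>I. mid (G i) (\<lambda>x. h (\<iota> i x)))" by (auto simp: mid_def)
  finally show ?thesis .
qed

section \<open>Chains of sets as Goedel algebras, and their ordinal sums\<close>

text \<open>The universal property speaks of homomorphisms into Goedel algebras, so a chain map
  needs a codomain of that kind; the last two claims translate between the two notions.\<close>

lemma godel_algebra_chain:
  fixes \<C> :: "'b set set"
  assumes chain: "\<And>A B. \<lbrakk>A \<in> \<C>; B \<in> \<C>\<rbrakk> \<Longrightarrow> A \<subseteq> B \<or> B \<subseteq> A" and \<C>: "{} \<in> \<C>" "UNIV \<in> \<C>"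
  defines "K \<equiv> \<lparr>carrier = \<C>, eq = (=), le = (\<subseteq>)\<rparr>"
  shows "godel_algebra K"
    and "f \<in> godel_hom G K \<Longrightarrow> chain_map G f"
    and "\<lbrakk>godel_algebra G; chain_map G g; g \<in> carrier G \<rightarrow> \<C>\<rbrakk> \<Longrightarrow> g \<in> godel_hom G K"
proof -
  define imp where "imp A B = (if A \<subseteq> B then UNIV else B)" for A B :: "'b set"
  have un: "A \<union> B \<in> \<C>" and int: "A \<inter> B \<in> \<C>" if "A \<in> \<C>" "B \<in> \<C>" for A B
    using chain[OF that] that by (auto simp: Un_absorb1 Un_absorb2 Int_absorb1 Int_absorb2)
  have imp: "imp A B \<in> \<C>" if "A \<in> \<C>" "B \<in> \<C>" for A B
    using that \<C> by (simp add: imp_def)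
  have imp_iff: "W \<subseteq> imp A B \<longleftrightarrow> W \<inter> A \<subseteq> B" if "W \<in> \<C>" "A \<in> \<C>" "B \<in> \<C>" for W A B
    using chain[OF that(1,2)] by (auto simp: imp_def)
  have pl: "UNIV \<subseteq> imp A B \<union> imp B A" if "A \<in> \<C>" "B \<in> \<C>" for A B
    using chain[OF that] by (auto simp: imp_def)
  have car: "carrier K = \<C>" by (simp add: K_def)
  have K: "godel_algebra K \<and> \<bottom>\<^bsub>K\<^esub> = {} \<and> \<top>\<^bsub>K\<^esub> = UNIV \<and>
    (\<forall>A\<in>\<C>. \<forall>B\<in>\<C>. A \<sqinter>\<^bsub>K\<^esub> B = A \<inter> B \<and> A \<squnion>\<^bsub>K\<^esub> B = A \<union> B \<and> A \<leadsto>\<^bsub>K\<^esub> B = imp A B)"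
    by (intro conjI ballI;
        rule godel_algebraI[of K "{}" UNIV "(\<inter>)" "(\<union>)" imp])
       (use un int imp \<C> pl in \<open>auto simp: K_def imp_iff\<close>)
  then show Kg: "godel_algebra K" by blast
  show "chain_map G f" if "f \<in> godel_hom G K"
    using godel_homD(2)[OF that] K chain
    by (auto simp: chain_map_def godel_homD[OF that] car imp_def)
  show "g \<in> godel_hom G K" if G: "godel_algebra G" and g: "chain_map G g" "g \<in> carrier G \<rightarrow> \<C>"
    using G Kg by (rule godel_homI)
      (use g K in \<open>auto simp: car chain_mapD[OF g(1)] imp_def Pi_iff\<close>)
qed

text \<open>The union and the intersection of two comparable sets are among the two sets, so an
  order embedding preserves them.\<close>

lemma chain_map_embed:
  assumes h: "chain_map G h" and e: "e {} = {}" "e UNIV = UNIV" "\<And>A B. e A \<subseteq> e B \<longleftrightarrow> A \<subseteq> B"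
  shows "chain_map G (\<lambda>x. e (h x))"
proof -
  have "e (A \<union> B) = e A \<union> e B" "e (A \<inter> B) = e A \<inter> e B" if "A \<subseteq> B \<or> B \<subseteq> A" for A B
    using that e(3)[of A B] e(3)[of B A]
    by (auto simp: Un_absorb1 Un_absorb2 Int_absorb1 Int_absorb2)
  then show ?thesis
    unfolding chain_map_def using e by (simp add: chain_mapD[OF h] if_distrib[of e])
qed

text \<open>
  The ordinal sum: the copies of the chains are stacked along the strict order \<open>r\<close>,
  sharing only their bottom and top.
\<close>

definition stack :: "('i \<times> 'i) set \<Rightarrow> 'i \<Rightarrow> 'b set \<Rightarrow> ('i \<times> 'b) set"
  where "stack r i A = (if A = {} then {} else if A = UNIV then UNIV
    else {(j, y). (j, i) \<in> r} \<union> {i} \<times> A)"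

text \<open>Irreflexivity keeps row \<open>i\<close> out of the part below, so \<open>A\<close> can
  be read off from row \<open>i\<close>.\<close>

lemma stack_subset_iff:
  assumes "irrefl r"
  shows "stack r i A \<subseteq> stack r i B \<longleftrightarrow> A \<subseteq> B"
proof -
  have "(i, i) \<notin> r" using assms by (simp add: irrefl_def)
  then have "y \<in> A \<longleftrightarrow> (i, y) \<in> stack r i A" for y and A :: "'b set"
    by (simp add: stack_def)
  then have "A \<subseteq> B" if "stack r i A \<subseteq> stack r i B" using that by blast
  moreover have "stack r i A \<subseteq> stack r i B" if "A \<subseteq> B"
    using that by (auto simp: stack_def)
  ultimately show ?thesis by blast
qed

text \<open>Row \<open>i\<close> and everything below it lie in the full rows under
  \<open>j\<close>. A point of \<open>B\<close> placed in row \<open>j\<close> is missing from the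
  smaller set, since \<open>(j, i) \<notin> r\<close>.\<close>

lemma stack_mid_psubset:
  assumes "trans r" "irrefl r" "(i, j) \<in> r" "A \<notin> {{}, UNIV}" "B \<notin> {{}, UNIV}"
  shows "stack r i A \<subset> stack r j B"
proof -
  have "stack r i A \<subseteq> stack r j B" using assms by (auto simp: stack_def dest: transD)
  moreover obtain y where "y \<in> B" using assms by auto
  then have "(j, y) \<in> stack r j B" "(j, y) \<notin> stack r i A"
    using assms by (auto simp: stack_def irrefl_def dest: transD)
  ultimately show ?thesis by blast
qed

lemma stack_empty_iff [simp]: "stack r i A = {} \<longleftrightarrow> A = {}"
  by (auto simp: stack_def)

lemma stack_UNIV_iff [simp]:
  "irrefl r \<Longrightarrow> stack r i A = UNIV \<longleftrightarrow> A = UNIV"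
  using stack_subset_iff[of r i UNIV A] by (simp add: stack_def top.extremum_unique)

text \<open>The strict part of a well-ordering of the index type.\<close>

lemma strict_total_order_exists:
  obtains r :: "('i \<times> 'i) set" where "trans r" "irrefl r" "\<And>i j. i \<noteq> j \<Longrightarrow> (i, j) \<in> r \<or> (j, i) \<in> r"
proof -
  obtain w :: "('i \<times> 'i) set" where w: "well_order_on UNIV w" using well_order_on by blast
  then have lin: "linear_order_on UNIV w" by (simp add: well_order_on_def)
  show thesis
  proof (rule that[of "w - Id"])
    show "trans (w - Id)"
      using lin by (auto simp: order_on_defs intro: trans_diff_Id)
    show "irrefl (w - Id)" by (simp add: irrefl_def)
    show "(i, j) \<in> w - Id \<or> (j, i) \<in> w - Id" if "i \<noteq> j" for i j
      using lin that by (auto simp: order_on_defs total_on_def)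
  qed
qed

section \<open>Lower and upper bounds for the depth of the coproduct\<close>

lemma coproduct_depth_lower:
  fixes G :: "'i \<Rightarrow> 'a gorder" and n :: "'i \<Rightarrow> nat"
  assumes C: "is_coproduct I G C \<iota>" and G: "\<And>i. i \<in> I \<Longrightarrow> godel_algebra (G i)"
    and nt: "\<And>i. i \<in> I \<Longrightarrow> nontrivial (G i)"
    and F: "finite F" "F \<subseteq> I" and n: "\<And>i. i \<in> F \<Longrightarrow> enat (n i) < depth (G i)"
  shows "enat (\<Sum>i\<in>F. n i) < depth C"
proof -
  \<comment> \<open>The universal property demands a map from every factor. Outside
    \<open>F\<close>, the value 0 asks only that some chain map exists, which nontriviality
    provides.\<close>
  define n' where "n' i = (if i \<in> F then n i else 0)" for i
  have "\<exists>(h :: 'a \<Rightarrow> 'a set) A. chain_map (G i) h \<and> finite A \<and> A \<subseteq> mid (G i) h \<and> card A = n' i"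
    if "i \<in> I" for i
  proof -
    have "enat (n' i) < depth (G i)"
      using depth_pos[OF G nt] n that by (simp add: n'_def zero_enat_def)
    then show ?thesis using less_depth_iff_chain_map[OF G[OF that]] by blast
  qed
  then obtain h :: "'i \<Rightarrow> 'a \<Rightarrow> 'a set" and A
    where h: "\<And>i. i \<in> I \<Longrightarrow> chain_map (G i) (h i)"
      and A: "\<And>i. i \<in> I \<Longrightarrow> finite (A i) \<and> A i \<subseteq> mid (G i) (h i) \<and> card (A i) = n' i"
    by metis
  obtain r :: "('i \<times> 'i) set"
    where r: "trans r" "irrefl r" "\<And>i j. i \<noteq> j \<Longrightarrow> (i, j) \<in> r \<or> (j, i) \<in> r"
    using strict_total_order_exists by blast
  define f where "f i x = stack r i (h i x)" for i x
  have f: "chain_map (G i) (f i)" if "i \<in> I" for i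
    unfolding f_def by (rule chain_map_embed[OF h[OF that]])
      (simp_all add: r stack_subset_iff)
  \<comment> \<open>Bottom and top are added explicitly to cover empty \<open>I\<close>.\<close>
  define \<C> where "\<C> = {{}, UNIV} \<union> (\<Union>i\<in>I. f i ` carrier (G i))"
  have cmp: "stack r i X \<subseteq> stack r j Y \<or> stack r j Y \<subseteq> stack r i X" if "i \<noteq> j" for i j X Y
  proof (cases "X \<in> {{}, UNIV} \<or> Y \<in> {{}, UNIV}")
    case False
    then show ?thesis
      using r(3)[OF that] stack_mid_psubset[OF r(1,2), of i j X Y] stack_mid_psubset[OF r(1,2), of j i Y X]
      by blast
  qed (auto simp: stack_def)
  have chain: "X \<subseteq> Y \<or> Y \<subseteq> X" if "X \<in> \<C>" "Y \<in> \<C>" for X Y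
  proof (cases "X \<in> {{}, UNIV} \<or> Y \<in> {{}, UNIV}")
    case False
    then obtain i x j y where "i \<in> I" "x \<in> carrier (G i)" "X = f i x" "j \<in> I" "y \<in> carrier (G j)" "Y = f j y"
      using \<open>X \<in> \<C>\<close> \<open>Y \<in> \<C>\<close> unfolding \<C>_def by blast
    then show ?thesis using chain_mapD(3)[OF f, of i x y] cmp[of i j] by (cases "i = j") (simp_all add: f_def)
  qed auto
  define K :: "('i \<times> 'a) set gorder"
    where "K = \<lparr>carrier = \<C>, eq = (=), le = (\<subseteq>)\<rparr>"
  have \<C>: "{} \<in> \<C>" "UNIV \<in> \<C>" by (auto simp: \<C>_def)
  have K: "godel_algebra K"
    unfolding K_def by (rule godel_algebra_chain(1)[OF chain \<C>])
  have fK: "f i \<in> godel_hom (G i) K" if "i \<in> I" for i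
    unfolding K_def
    by (rule godel_algebra_chain(3)[OF chain \<C> G[OF that] f[OF that]]) (use that in \<open>auto simp: \<C>_def\<close>)
  have Cg: "godel_algebra C" and \<iota>: "\<And>i. i \<in> I \<Longrightarrow> \<iota> i \<in> godel_hom (G i) C"
    using C by (auto simp: is_coproduct_def is_coproduct_wrt_def)
  obtain u where u: "u \<in> godel_hom C K"
    and u\<iota>: "\<And>i x. \<lbrakk>i \<in> I; x \<in> carrier (G i)\<rbrakk> \<Longrightarrow> u (\<iota> i x) = f i x"
  proof -
    \<comment> \<open>The ordinal sum consists of sets of pairs, which is not the test type in
      \<open>is_coproduct\<close>.\<close>
    have "is_coproduct_wrt TYPE(('i \<times> 'a) set) I G C \<iota>" by (rule is_coproduct_imp_wrt[OF C G])
    then have "godel_algebra K \<and> (\<forall>i\<in>I. f i \<in> godel_hom (G i) K) \<longrightarrow>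
      (\<exists>!u. u \<in> godel_hom C K \<and> u \<in> extensional (carrier C) \<and>
         (\<forall>i\<in>I. \<forall>x\<in>carrier (G i). u (\<iota> i x) = f i x))"
      unfolding is_coproduct_wrt_def by (elim conjE allE)
    then show thesis using K fK that by blast
  qed
  have cu: "chain_map C u"
    by (rule godel_algebra_chain(2)[OF chain \<C> u[unfolded K_def]])
  let ?B = "\<lambda>i. stack r i ` A i"
  have AI: "finite (A i)" "A i \<subseteq> mid (G i) (h i)" "card (A i) = n i" if "i \<in> F" for i
    using A[of i] that F(2) by (auto simp: n'_def)
  have mid: "(\<Union>i\<in>F. ?B i) \<subseteq> mid C u"
  proof clarify
    fix i X assume iX: "i \<in> F" "X \<in> A i"
    then obtain x where x: "x \<in> carrier (G i)" "X = h i x" "X \<notin> {{}, UNIV}"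
      using AI(2) unfolding mid_def by blast
    have "i \<in> I" using iX F by blast
    then have "stack r i X = u (\<iota> i x)" "\<iota> i x \<in> carrier C"
      using x u\<iota> godel_homD(2)[OF \<iota>] by (simp_all add: f_def)
    then show "stack r i X \<in> mid C u" using x(3) r(2) by (auto simp: mid_def)
  qed
  have "card (\<Union>i\<in>F. ?B i) = (\<Sum>i\<in>F. card (?B i))"
  proof (rule card_UN_disjoint[OF F(1)])
    show "\<forall>i\<in>F. finite (?B i)" using AI by simp
    show "\<forall>i\<in>F. \<forall>j\<in>F. i \<noteq> j \<longrightarrow> ?B i \<inter> ?B j = {}"
    proof (intro ballI impI equals0I)
      fix i j Z assume ij: "i \<in> F" "j \<in> F" "i \<noteq> j" "Z \<in> ?B i \<inter> ?B j"
      then obtain X Y where XY: "X \<in> A i" "Y \<in> A j" "stack r i X = stack r j Y" by blast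
      moreover have "X \<notin> {{}, UNIV}" "Y \<notin> {{}, UNIV}"
        using XY AI(2) ij by (auto simp: mid_def)
      ultimately show False
        using r(3)[OF ij(3)] stack_mid_psubset[OF r(1,2), of i j X Y]
          stack_mid_psubset[OF r(1,2), of j i Y X] by auto
    qed
  qed
  also have "card (?B i) = n i" if "i \<in> F" for i
  proof -
    have "inj_on (stack r i) (A i)"
      \<comment> \<open>\<open>stack r i\<close> reflects inclusion, hence equality.\<close>
      by (rule inj_onI) (metis equalityE stack_subset_iff[OF r(2)] subset_antisym)
    then show ?thesis using AI(3)[OF that] by (simp add: card_image)
  qed
  then have "(\<Sum>i\<in>F. card (?B i)) = (\<Sum>i\<in>F. n i)" by simp
  finally have "C \<notin> GA (\<Sum>i\<in>F. n i)"
    using not_GA_if_chain_map[OF Cg cu _ mid] F AI by simp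
  then show ?thesis by (simp add: less_depth_iff)
qed

text \<open>A chain map on the coproduct restricts to each factor, where it takes at most
  \<open>d i - 1\<close> intermediate values; by \<open>mid_coproduct\<close> these restrictions
  account for all of them.\<close>

lemma coproduct_depth_upper:
  fixes G :: "'i \<Rightarrow> 'a gorder" and C :: "'c gorder"
  assumes C: "is_coproduct I G C \<iota>" and G: "\<And>i. i \<in> I \<Longrightarrow> godel_algebra (G i)"
    and J: "finite J" "J \<subseteq> I" and d: "\<And>i. i \<in> I \<Longrightarrow> depth (G i) = enat (d i)"
    and out: "\<And>i. i \<in> I - J \<Longrightarrow> d i \<le> 1"
  shows "depth C \<le> enat (Suc (\<Sum>i\<in>J. d i - 1))"
proof -
  have Cg: "godel_algebra C" and \<iota>: "\<And>i. i \<in> I \<Longrightarrow> \<iota> i \<in> godel_hom (G i) C"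
    using C by (auto simp: is_coproduct_def is_coproduct_wrt_def)
  have "\<not> enat (Suc (\<Sum>i\<in>J. d i - 1)) < depth C"
  proof
    assume "enat (Suc (\<Sum>i\<in>J. d i - 1)) < depth C"
    then obtain h :: "'c \<Rightarrow> 'c set" and A where h: "chain_map C h"
      and A: "finite A" "A \<subseteq> mid C h" "card A = Suc (\<Sum>i\<in>J. d i - 1)"
      using less_depth_iff_chain_map[OF Cg] by blast
    let ?M = "\<lambda>i. mid (G i) (\<lambda>x. h (\<iota> i x))"
    have M: "finite (?M i)" "card (?M i) \<le> d i - 1" if "i \<in> I" for i
      using finite_mid[OF G[OF that] chain_map_comp_hom[OF h \<iota>[OF that]] d[OF that]] by auto
    \<comment> \<open>Here \<open>d i - 1\<close> is 0, as subtraction on \<open>nat\<close> is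
      truncated.\<close>
    have "?M i = {}" if "i \<in> I - J" for i
      using M[of i] out[OF that] that by auto
    then have "A \<subseteq> (\<Union>i\<in>J. ?M i)" using A(2) mid_coproduct[OF C G h] by blast
    then have "card A \<le> card (\<Union>i\<in>J. ?M i)" using M J by (intro card_mono) auto
    also have "\<dots> \<le> (\<Sum>i\<in>J. card (?M i))" by (rule card_UN_le[OF J(1)])
    also have "\<dots> \<le> (\<Sum>i\<in>J. d i - 1)" using M J by (intro sum_mono) auto
    finally show False using A(3) by simp
  qed
  then show ?thesis by simp
qed

theorem theorem4p9:
  fixes I :: "'i set" and G :: "'i \<Rightarrow> 'a gorder"
    and C :: "'c gorder" and \<iota> :: "'i \<Rightarrow> 'a \<Rightarrow> 'c"
  assumes "\<And>i. i \<in> I \<Longrightarrow> godel_algebra (G i)"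
    and "\<And>i. i \<in> I \<Longrightarrow> nontrivial (G i)"
    and "is_coproduct I G C \<iota>"
  shows "let J = {i \<in> I. depth (G i) > 1} in
    depth C = (if (\<exists>i\<in>I. depth (G i) = \<infinity>) \<or> infinite J then \<infinity>
               else 1 + (\<Sum>i\<in>J. (depth (G i) - 1)))"
proof -
  define J where "J = {i \<in> I. depth (G i) > 1}"
  have lower: "enat (\<Sum>i\<in>F. n i) < depth C"
    if "finite F" "F \<subseteq> I" "\<And>i. i \<in> F \<Longrightarrow> enat (n i) < depth (G i)" for F n
    by (rule coproduct_depth_lower[OF assms(3,1,2) that])
  have inf: "depth C = \<infinity>" if "\<And>n. enat n < depth C"
    using that by (metis enat_ord_simps(5) less_irrefl not_infinity_eq)
  have "depth C = (if (\<exists>i\<in>I. depth (G i) = \<infinity>) \<or> infinite J then \<infinity>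
               else 1 + (\<Sum>i\<in>J. (depth (G i) - 1)))"
  proof (cases "(\<exists>i\<in>I. depth (G i) = \<infinity>) \<or> infinite J")
    case True
    have "enat n < depth C" for n
    proof (cases "infinite J")
      case True
      then obtain F where "finite F" "F \<subseteq> J" "card F = n" by (meson infinite_arbitrarily_large)
      \<comment> \<open>Each of \<open>n\<close> factors of depth above 1 contributes one
        intermediate value.\<close>
      then show ?thesis using lower[of F "\<lambda>_. 1"] by (auto simp: J_def one_enat_def)
    next
      case False
      \<comment> \<open>A single factor of infinite depth contributes arbitrarily many
        values.\<close>
      with True obtain i where "i \<in> I" "depth (G i) = \<infinity>" by blast
      then show ?thesis using lower[of "{i}" "\<lambda>_. n"] by auto
    qed
    then show ?thesis using True inf by simp
  next
    case False
    define d where "d i = the_enat (depth (G i))" for i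
    have d: "depth (G i) = enat (d i)" if "i \<in> I" for i
      using False that unfolding d_def by (metis not_enat_eq the_enat.simps)
    have J: "finite J" "J \<subseteq> I" using False by (auto simp: J_def)
    \<comment> \<open>Every factor in \<open>J\<close> contributes \<open>d i - 1\<close> values,
      the most allowed below its depth; the strict inequality supplies the summand 1.\<close>
    have "enat (\<Sum>i\<in>J. d i - 1) < depth C"
      by (rule lower[OF J]) (auto simp: J_def d one_enat_def)
    then have "enat (Suc (\<Sum>i\<in>J. d i - 1)) \<le> depth C"
      by (metis Suc_ile_eq)
    moreover have "depth C \<le> enat (Suc (\<Sum>i\<in>J. d i - 1))"
      by (rule coproduct_depth_upper[OF assms(3,1) J d]) (auto simp: J_def d one_enat_def)
    ultimately have "depth C = 1 + enat (\<Sum>i\<in>J. d i - 1)"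
      by (simp add: one_enat_def)
    also have "enat (\<Sum>i\<in>J. d i - 1) = (\<Sum>i\<in>J. enat (d i - 1))"
      by (simp add: of_nat_eq_enat[symmetric])
    also have "\<dots> = (\<Sum>i\<in>J. depth (G i) - 1)"
      using J by (intro sum.cong) (auto simp: d one_enat_def)
    finally show ?thesis unfolding if_not_P[OF False] .
  qed
  then show ?thesis unfolding J_def Let_def .
qed

end
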